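(* Let $0<\beta<1$ and $T>0$. For every $p,q\ge1$ and $h\in\mathcal{H}_{1/2}$, the derivative operator $$\partial_{1,h}:\mathcal{F}C_b^\infty\longrightarrow L^p(\mathbb{W}\times\mathbb{R}^+,\mathcal{F}^{X_{\beta,T}},\mathbb{P}_{1/2}\otimes\mathbb{P}_{Y_\beta})$$ is closable on $L^q(\mathbb{W}\times\mathbb{R}^+,\mathcal{F}^{X_{\beta,T}},\mathbb{P}_{1/2}\otimes\mathbb{P}_{Y_\beta})$; that is, if $(F_n)_{n\in\mathbb{N}}\subset\mathcal{F}C_b^\infty$ satisfies $F_n\to0$ in $L^q$ and $\partial_{1,h}F_n\to Z$ in $L^p$, then $Z=0$.
   Context: $\mathbb{R}^+=[0,\infty)$. $\mathbb{W}$ is the space of continuous $w:\mathbb{R}^+\to\mathbb{R}$ with $w(0)=0$, with the topology of locally uniform convergence; $\mathbb{P}_{1/2}$ is Wiener measure on $\mathbb{W}$. $\mathbb{P}_{Y_\beta}$ is the probability measure on $\mathbb{R}^+$ with density $M_\beta$ determined by $\int_0^\infty e^{-s\tau}M_\beta(\tau)\,d\tau=E_\beta(-s)$, $s\ge0$, with $E_\beta(z)=\sum_{n\ge0}z^n/\Gamma(\beta n+1)$. Put $X_{\beta,T}(t)(w,\tau)=w(t\tau)$ for $t\in[0,T]$ and $\mathcal{F}^{X_{\beta,T}}=\sigma(X_{\beta,T}(t),t\in[0,T])$. Elements of $L^p$ spaces are identified when equal $\mathbb{P}_{1/2}\otimes\mathbb{P}_{Y_\beta}$-a.s. $\mathcal{H}_{1/2}$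 is the space of functions $h(t)=\int_0^t\dot h(s)\,\mathrm{d}s$ with $\dot h\in L^2(\mathbb{R}^+)$ (Lebesgue measure). $\mathcal{F}C_b^\infty$ (depending on $T$) is the class of functions $F(w,\tau)=f(w(t_1\tau),\dots,w(t_n\tau))$ on $\mathbb{W}\times\mathbb{R}^+$ with $n\in\mathbb{N}$, $0<t_1<\dots<t_n\le T$ and $f\in C_b^\infty(\mathbb{R}^n)$, the set of $C^\infty$ real-valued functions bounded together with all their partial derivatives. For such $F$ and $h\in\mathcal{H}_{1/2}$, $(\partial_{1,h}F)(w,\tau)=\lim_{\varepsilon\to0}\varepsilon^{-1}(F(w+\varepsilon h,\tau)-F(w,\tau))=\sum_i\partial_if(w(t_1\tau),\dots,w(t_n\tau))h(t_i\tau)$. *)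

theory Defs
  imports "HOL-Probability.Probability"
begin

section \<open>Wiener space\<close>

text \<open>A function on $[0,\infty)$ is encoded as a total function on the reals that vanishes on
  the negative half-line, so that sums and scalar multiples can be taken pointwise.\<close>

definition wiener_space :: "(real \<Rightarrow> real) set" where
  "wiener_space = {w. continuous_on {0..} w \<and> w 0 = 0 \<and> (\<forall>t<0. w t = 0)}"

text \<open>The topology of locally uniform convergence.\<close>

definition wiener_topology :: "(real \<Rightarrow> real) topology" where
  "wiener_topology = topology (\<lambda>U. U \<subseteq> wiener_space \<and>
     (\<forall>w\<in>U. \<exists>K\<ge>0. \<exists>e>0. \<forall>v\<in>wiener_space. (\<forall>t\<in>{0..K}. \<bar>v t - w t\<bar> < e) \<longrightarrow> v \<in> U))"

lemma openin_wiener_topology: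
  "openin wiener_topology U \<longleftrightarrow> U \<subseteq> wiener_space \<and>
     (\<forall>w\<in>U. \<exists>K\<ge>0. \<exists>e>0. \<forall>v\<in>wiener_space. (\<forall>t\<in>{0..K}. \<bar>v t - w t\<bar> < e) \<longrightarrow> v \<in> U)"
proof -
  let ?P = "\<lambda>U w K e. \<forall>v\<in>wiener_space. (\<forall>t\<in>{0..K::real}. \<bar>v t - w t\<bar> < (e::real)) \<longrightarrow> v \<in> U"
  have "istopology (\<lambda>U. U \<subseteq> wiener_space \<and> (\<forall>w\<in>U. \<exists>K\<ge>0. \<exists>e>0. ?P U w K e))"
    unfolding istopology_def
  proof (intro conjI allI impI)
    fix S U assume S: "S \<subseteq> wiener_space \<and> (\<forall>w\<in>S. \<exists>K\<ge>0. \<exists>e>0. ?P S w K e)"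
      and U: "U \<subseteq> wiener_space \<and> (\<forall>w\<in>U. \<exists>K\<ge>0. \<exists>e>0. ?P U w K e)"
    then show "S \<inter> U \<subseteq> wiener_space" by blast
    show "\<forall>w\<in>S \<inter> U. \<exists>K\<ge>0. \<exists>e>0. ?P (S \<inter> U) w K e"
    proof
      fix w assume "w \<in> S \<inter> U"
      with S U obtain K1 e1 K2 e2 where "K1 \<ge> 0" "e1 > 0" "K2 \<ge> 0" "e2 > 0"
        and P: "?P S w K1 e1" "?P U w K2 e2" by (metis IntE)
      moreover from P have "?P (S \<inter> U) w (max K1 K2) (min e1 e2)"
        by (simp add: le_max_iff_disj)
      ultimately show "\<exists>K\<ge>0. \<exists>e>0. ?P (S \<inter> U) w K e"
        by (intro exI[of _ "max K1 K2"] conjI exI[of _ "min e1 e2"]) auto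
    qed
  next
    fix \<K> assume K: "\<forall>S\<in>\<K>. S \<subseteq> wiener_space \<and> (\<forall>w\<in>S. \<exists>K\<ge>0. \<exists>e>0. ?P S w K e)"
    then show "\<Union>\<K> \<subseteq> wiener_space" by blast
    show "\<forall>w\<in>\<Union>\<K>. \<exists>K\<ge>0. \<exists>e>0. ?P (\<Union>\<K>) w K e"
      using K by (meson Union_iff)
  qed
  then show ?thesis
    unfolding wiener_topology_def by (simp add: topology_inverse')
qed

definition wiener_borel :: "(real \<Rightarrow> real) measure" where
  "wiener_borel = sigma wiener_space {U. openin wiener_topology U}"

text \<open>Wiener measure: the Borel probability measure under which the coordinate process is a
  standard Brownian motion.\<close>

definition wiener_measure :: "(real \<Rightarrow> real) measure \<Rightarrow> bool" where
  "wiener_measure P \<longleftrightarrow>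
     sets P = sets wiener_borel \<and> prob_space P \<and>
     (\<forall>s t. 0 \<le> s \<and> s < t \<longrightarrow>
        distributed P lborel (\<lambda>w. w t - w s) (normal_density 0 (sqrt (t - s)))) \<and>
     (\<forall>n (t :: nat \<Rightarrow> real). 0 \<le> t 0 \<and> strict_mono_on {..n} t \<longrightarrow>
        prob_space.indep_vars P (\<lambda>_. borel) (\<lambda>i w. w (t (Suc i)) - w (t i)) {..<n})"

text \<open>Absolutely continuous functions with square-integrable derivative (Cameron--Martin space).\<close>

definition cameron_martin :: "(real \<Rightarrow> real) set" where
  "cameron_martin = {h. \<exists>h'. set_borel_measurable lborel {0..} h' \<and>
     set_integrable lborel {0..} (\<lambda>s. (h' s)\<^sup>2) \<and>
     (\<forall>t\<ge>0. h t = (LBINT s:{0..t}. h' s)) \<and> (\<forall>t<0. h t = 0)}"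

section \<open>The random time\<close>

definition mittag_leffler :: "real \<Rightarrow> real \<Rightarrow> real" where
  "mittag_leffler \<beta> z = (\<Sum>n. z ^ n / Gamma (\<beta> * real n + 1))"

text \<open>This determines \<open>M\<close> on $[0,\infty)$ up to null sets; the case \<open>s = 0\<close> says that \<open>M\<close>
  is a probability density.\<close>

definition mittag_leffler_density :: "real \<Rightarrow> (real \<Rightarrow> real) \<Rightarrow> bool" where
  "mittag_leffler_density \<beta> M \<longleftrightarrow>
     M \<in> borel_measurable borel \<and> (\<forall>\<tau>\<ge>0. 0 \<le> M \<tau>) \<and>
     (\<forall>s\<ge>0. set_integrable lborel {0..} (\<lambda>\<tau>. exp (- s * \<tau>) * M \<tau>) \<and>
            (LBINT \<tau>:{0..}. exp (- s * \<tau>) * M \<tau>) = mittag_leffler \<beta> (- s))"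

definition time_law :: "(real \<Rightarrow> real) \<Rightarrow> real measure" where
  "time_law M = density (restrict_space lborel {0..}) (\<lambda>\<tau>. ennreal (M \<tau>))"

section \<open>The time-changed process and its cylinder functions\<close>

definition X_proc :: "real \<Rightarrow> (real \<Rightarrow> real) \<times> real \<Rightarrow> real" where
  "X_proc t = (\<lambda>(w, \<tau>). w (t * \<tau>))"

definition X_algebra :: "real \<Rightarrow> ((real \<Rightarrow> real) \<times> real) measure" where
  "X_algebra T = sigma (wiener_space \<times> {0..})
     {X_proc t -` B \<inter> (wiener_space \<times> {0..}) | t B. t \<in> {0..T} \<and> B \<in> sets borel}"

text \<open>A function on $\mathbb{R}^n$ is encoded as a function of a sequence that depends on the
  coordinates \<open>0, \<dots>, n - 1\<close> only. For such a function, continuity in the product topology is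
  continuity on $\mathbb{R}^n$.\<close>

definition partial_deriv :: "nat \<Rightarrow> ((nat \<Rightarrow> real) \<Rightarrow> real) \<Rightarrow> (nat \<Rightarrow> real) \<Rightarrow> real" where
  "partial_deriv i f x = deriv (\<lambda>s. f (x(i := s))) (x i)"

definition Cb_infinity :: "nat \<Rightarrow> ((nat \<Rightarrow> real) \<Rightarrow> real) set" where
  "Cb_infinity n = {f. (\<forall>x y. (\<forall>i<n. x i = y i) \<longrightarrow> f x = f y) \<and>
     (\<forall>is. set is \<subseteq> {..<n} \<longrightarrow>
        (let g = foldr partial_deriv is f in
           bounded (range g) \<and> continuous_on UNIV g \<and>
           (\<forall>i<n. \<forall>x. (\<lambda>s. g (x(i := s))) differentiable (at (x i)))))}"

definition cylinder_functions :: "real \<Rightarrow> ((real \<Rightarrow> real) \<times> real \<Rightarrow> real) set" where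
  "cylinder_functions T = {F. \<exists>n t f. (\<forall>i<n. 0 < t i \<and> t i \<le> T) \<and> strict_mono_on {..<n} t \<and>
     f \<in> Cb_infinity n \<and> F = (\<lambda>(w, \<tau>). f (\<lambda>i. w (t i * \<tau>)))}"

definition dir_deriv :: "(real \<Rightarrow> real) \<Rightarrow> ((real \<Rightarrow> real) \<times> real \<Rightarrow> real) \<Rightarrow>
    (real \<Rightarrow> real) \<times> real \<Rightarrow> real" where
  "dir_deriv h F = (\<lambda>(w, \<tau>).
     Lim (at 0) (\<lambda>\<epsilon>. (F (\<lambda>s. w s + \<epsilon> * h s, \<tau>) - F (w, \<tau>)) / \<epsilon>))"

section \<open>Closability between Lebesgue spaces\<close>

text \<open>\<open>Lp_fun p Q G\<close> consists of the \<open>G\<close>-measurable representatives of the elements of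
  $L^p(\Omega, G, Q)$, for a sub-\<open>\<sigma>\<close>-algebra \<open>G\<close> of the domain of \<open>Q\<close>.\<close>

definition Lp_fun :: "real \<Rightarrow> 'a measure \<Rightarrow> 'a measure \<Rightarrow> ('a \<Rightarrow> real) set" where
  "Lp_fun p Q G = {f \<in> borel_measurable G. integrable Q (\<lambda>x. \<bar>f x\<bar> powr p)}"

definition Lp_tendsto :: "real \<Rightarrow> 'a measure \<Rightarrow> (nat \<Rightarrow> 'a \<Rightarrow> real) \<Rightarrow> ('a \<Rightarrow> real) \<Rightarrow> bool" where
  "Lp_tendsto p Q f g \<longleftrightarrow> (\<lambda>n. \<integral>\<^sup>+ x. ennreal (\<bar>f n x - g x\<bar> powr p) \<partial>Q) \<longlonglongrightarrow> 0"

text \<open>The first two clauses say that \<open>A\<close> is a map from a subset \<open>D\<close> of $L^q(\Omega, G, Q)$ to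
  $L^p(\Omega, G, Q)$. A function \<open>A F\<close> need not itself be \<open>G\<close>-measurable, but must equal a
  \<open>G\<close>-measurable one outside a null set of \<open>Q\<close> (not merely of the restriction of \<open>Q\<close>
  to \<open>G\<close>, which has fewer null sets).\<close>

definition Lp_closable :: "'a measure \<Rightarrow> 'a measure \<Rightarrow> real \<Rightarrow> real \<Rightarrow>
    ('a \<Rightarrow> real) set \<Rightarrow> (('a \<Rightarrow> real) \<Rightarrow> 'a \<Rightarrow> real) \<Rightarrow> bool" where
  "Lp_closable Q G q p D A \<longleftrightarrow>
     D \<subseteq> Lp_fun q Q G \<and>
     (\<forall>F\<in>D. \<exists>g\<in>Lp_fun p Q G. AE x in Q. A F x = g x) \<and>
     (\<forall>F Z. (\<forall>n. F n \<in> D) \<and> Z \<in> Lp_fun p Q G \<and>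
        Lp_tendsto q Q F (\<lambda>_. 0) \<and> Lp_tendsto p Q (\<lambda>n. A (F n)) Z \<longrightarrow>
        (AE x in Q. Z x = 0))"

end

theory Submission
  imports Defs
begin

text \<open>Conditionally on the random time \<open>\<tau>\<close>, a cylinder function is a smooth function of finitely many
  values of a Brownian path, and \<open>\<partial>\<^sub>1\<^sub>,\<^sub>h\<close> is the derivative along the Cameron--Martin direction
  \<open>h\<close>. Closability on the product space therefore reduces, by Fubini's theorem, to closability on
  Wiener space for almost every fixed \<open>\<tau> > 0\<close>: if the integrals of \<open>\<bar>F\<^sub>n\<bar>\<close> and \<open>\<bar>\<partial>F\<^sub>n - Z\<bar>\<close> tend to
  \<open>0\<close>, indices can be chosen along which they are summable, and summability passes to almost every
  \<open>\<tau>\<close>-section (\<open>AE_slice_summable\<close>). This \<open>L\<^sup>1\<close> convergence follows from convergence in \<open>L\<^sup>q\<close> and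
  \<open>L\<^sup>p\<close> because the measure has total mass \<open>1\<close>.

  On Wiener space the tool is integration by parts: for a smooth cylinder function \<open>F\<close> there is a
  random variable \<open>W\<close> with \<open>E[\<partial>\<^sub>hF] = E[F W]\<close> and \<open>E[W\<^sup>2] \<le> \<integral>\<bar>h'\<bar>\<^sup>2\<close> (\<open>cylinder_ibp\<close>). On the time
  grid of \<open>F\<close> the variable \<open>W\<close> is \<open>\<Sum> (\<Delta>h / \<Delta>t) \<Delta>w\<close>, so the formula reduces to
  one-dimensional Gaussian integration by parts in each increment; the bound on \<open>W\<close> is the Cauchy--Schwarz inequality on the
  grid intervals and does not depend on the grid, so it is uniform along a sequence of cylinder
  functions.

  Since \<open>W\<close> is only square integrable while \<open>F\<^sub>n \<rightarrow> 0\<close> is known only in \<open>L\<^sup>1\<close>, the formula is applied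
  to the bounded functions \<open>arctan F\<^sub>n \<cdot> arctan (\<partial>\<^sub>hF\<^sub>k)\<close>. The right-hand side then vanishes as
  \<open>n \<rightarrow> \<infinity>\<close>, and because \<open>arctan\<close> has derivative \<open>1\<close> at \<open>0\<close> the limit of the left-hand side is
  \<open>E[Z arctan (\<partial>\<^sub>hF\<^sub>k)]\<close>. Letting \<open>k \<rightarrow> \<infinity>\<close> gives \<open>E[Z arctan Z] = 0\<close>, and as \<open>z arctan z > 0\<close> for
  \<open>z \<noteq> 0\<close> this forces \<open>Z = 0\<close> (\<open>closable_along_fast_sequence\<close>).

  That \<open>\<partial>\<^sub>1\<^sub>,\<^sub>h\<close> takes values in the \<open>L\<^sup>p\<close> space of \<open>\<sigma>(X)\<close> needs two further facts, because the
  derivative involves \<open>h (t\<^sub>i \<tau>)\<close>. First, \<open>\<tau>\<close> is almost surely a function of the path of \<open>X\<close>: the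
  quadratic variation of \<open>X\<close> over \<open>[0, T]\<close> is \<open>T \<tau>\<close> (\<open>recovered_time_eq\<close>). Second, \<open>\<bar>h (t\<^sub>i \<tau>)\<bar>\<close> grows
  at most like the square root of \<open>\<tau>\<close>, so integrability rests on the moments of \<open>\<tau>\<close>; they
  are finite because the Laplace transform \<open>E\<^sub>\<beta>(-s)\<close> is a convergent power series at \<open>s = 0\<close>
  (\<open>integrable_power_time_law\<close>).\<close>

section \<open>Functions with continuous bounded partial derivatives\<close>

lemma tendsto_fun_coordinatewise:
  fixes y :: "'b \<Rightarrow> 'i \<Rightarrow> real"
  assumes "\<And>i. ((\<lambda>d. y d i) \<longlongrightarrow> x i) F"
  shows "(y \<longlongrightarrow> x) F"
proof -
  have "limitin (product_topology (\<lambda>_::'i. euclideanreal) UNIV) y x F"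
    using assms by (simp add: limitin_componentwise)
  then show ?thesis
    by (simp add: euclidean_product_topology)
qed

lemma has_derivative_partial_deriv:
  assumes "\<forall>x. (\<lambda>s. f (x(i := s))) differentiable (at (x i))"
  shows "((\<lambda>s. f (x(i := s))) has_real_derivative partial_deriv i f (x(i := s))) (at s)"
proof -
  have "(\<lambda>u. f ((x(i := s))(i := u))) differentiable (at ((x(i := s)) i))"
    using assms by blast
  then have "(\<lambda>u. f (x(i := u))) differentiable (at s)" by simp
  then have "((\<lambda>u. f (x(i := u))) has_real_derivative deriv (\<lambda>u. f (x(i := u))) s) (at s)"
    by (simp add: DERIV_deriv_iff_real_differentiable)
  then show ?thesis by (simp add: partial_deriv_def)
qed

text \<open>The chain rule for continuous partial derivatives. The increment of \<open>f\<close> along the line is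
  split into one-coordinate increments, the mean value theorem turns each of them into a partial
  derivative at an intermediate point, and all intermediate points converge to the base point.\<close>

lemma has_derivative_along_line:
  fixes f :: "(nat \<Rightarrow> real) \<Rightarrow> real"
  assumes loc: "\<And>x y. (\<And>i. i < n \<Longrightarrow> x i = y i) \<Longrightarrow> f x = f y"
    and diff: "\<And>i. i < n \<Longrightarrow> \<forall>x. (\<lambda>s. f (x(i := s))) differentiable (at (x i))"
    and cont: "\<And>i. i < n \<Longrightarrow> continuous_on UNIV (partial_deriv i f)"
  shows "((\<lambda>\<epsilon>. f (\<lambda>i. a i + \<epsilon> * b i)) has_real_derivative
    (\<Sum>i<n. b i * partial_deriv i f (\<lambda>i. a i + \<epsilon> * b i))) (at \<epsilon>)"
proof -
  define x where "x = (\<lambda>i. a i + \<epsilon> * b i)"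
  \<comment> \<open>In \<open>z d k\<close> the first \<open>k\<close> coordinates have been moved; \<open>y \<theta> d k\<close> is the intermediate point between \<open>z d k\<close> and \<open>z d (Suc k)\<close>.\<close>
  define z where "z d k = (\<lambda>i. if i < k then x i + d * b i else x i)" for d :: real and k :: nat
  define y where "y \<theta> d k = (\<lambda>i. if i < k then x i + d * b i else
     if i = k then x i + \<theta> d k * (d * b i) else x i)" for \<theta> :: "real \<Rightarrow> nat \<Rightarrow> real" and d :: real and k :: nat
  define Q where "Q d k t \<longleftrightarrow> \<bar>t\<bar> \<le> 1 \<and> f (z d (Suc k)) - f (z d k) =
     d * b k * partial_deriv k f ((z d k)(k := x k + t * (d * b k)))" for d k t
  have ex: "\<exists>t. Q d k t" if k: "k < n" for d k
  proof -
    let ?g = "\<lambda>s. f ((z d k)(k := s))"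
    define c where "c = d * b k"
    have D: "(?g has_real_derivative partial_deriv k f ((z d k)(k := s))) (at s)" for s
      by (rule has_derivative_partial_deriv[OF diff[OF k]])
    have D2: "((\<lambda>r. ?g (x k + r * c)) has_real_derivative
        partial_deriv k f ((z d k)(k := x k + r * c)) * c) (at r)" for r
      by (rule DERIV_chain'[where f = "\<lambda>r. x k + r * c", OF _ D]) (auto intro!: derivative_eq_intros)
    obtain r where r: "0 < r" "r < 1" "?g (x k + 1 * c) - ?g (x k + 0 * c) =
       (1 - 0) * (partial_deriv k f ((z d k)(k := x k + r * c)) * c)"
      using MVT2[of 0 1 "\<lambda>r. ?g (x k + r * c)", OF _ D2] by auto
    have 1: "(z d k)(k := x k + 1 * c) = z d (Suc k)" "(z d k)(k := x k + 0 * c) = z d k"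
      by (auto simp: z_def c_def fun_eq_iff less_Suc_eq)
    show ?thesis
      using r by (intro exI[of _ r]) (simp only: 1 Q_def, simp add: c_def)
  qed
  define \<theta> where "\<theta> d k = (SOME t. Q d k t)" for d k
  have \<theta>: "\<bar>\<theta> d k\<bar> \<le> 1 \<and> f (z d (Suc k)) - f (z d k) =
     d * b k * partial_deriv k f ((z d k)(k := x k + \<theta> d k * (d * b k)))" if "k < n" for d k
  proof -
    have "Q d k (\<theta> d k)"
      unfolding \<theta>_def by (rule someI_ex[OF ex[OF that]])
    then show ?thesis by (simp only: Q_def)
  qed
  have upd: "(z d k)(k := x k + \<theta> d k * (d * b k)) = y \<theta> d k" for d k
    by (auto simp: z_def y_def fun_eq_iff)
  have ylim: "((\<lambda>d. y \<theta> d k) \<longlongrightarrow> x) (at 0)" if k: "k < n" for k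
  proof (rule tendsto_fun_coordinatewise)
    fix i
    have "((\<lambda>d. \<theta> d k * (d * b i)) \<longlongrightarrow> 0) (at 0)"
    proof (rule tendsto_0_le[of "\<lambda>d. d * b i" _ _ 1])
      show "((\<lambda>d. d * b i) \<longlongrightarrow> 0) (at 0)"
        by (auto intro!: tendsto_eq_intros)
      show "\<forall>\<^sub>F d in at 0. norm (\<theta> d k * (d * b i)) \<le> norm (d * b i) * 1"
        using \<theta>[OF k] by (auto intro!: always_eventually simp: abs_mult mult_left_le_one_le)
    qed
    then have 1: "((\<lambda>d. x i + \<theta> d k * (d * b i)) \<longlongrightarrow> x i) (at 0)"
      using tendsto_add[OF tendsto_const[of "x i"]] by fastforce
    have 2: "((\<lambda>d. x i + d * b i) \<longlongrightarrow> x i) (at 0)"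
      by (auto intro!: tendsto_eq_intros)
    show "((\<lambda>d. y \<theta> d k i) \<longlongrightarrow> x i) (at 0)"
      using 1 2 by (cases "i < k"; cases "i = k") (auto simp: y_def)
  qed
  have tele: "f (z d n) - f (z d 0) = (\<Sum>k<n. f (z d (Suc k)) - f (z d k))" for d
    using sum_lessThan_telescope[of "\<lambda>k. f (z d k)" n] by simp
  have eq: "(f (\<lambda>i. a i + (\<epsilon> + d) * b i) - f (\<lambda>i. a i + \<epsilon> * b i)) / d
      = (\<Sum>k<n. b k * partial_deriv k f (y \<theta> d k))" if "d \<noteq> 0" for d
  proof -
    have "f (\<lambda>i. a i + (\<epsilon> + d) * b i) = f (z d n)"
      by (rule loc) (auto simp: z_def x_def algebra_simps)
    moreover have "f (\<lambda>i. a i + \<epsilon> * b i) = f (z d 0)"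
      by (rule loc) (auto simp: z_def x_def)
    moreover have "f (z d n) - f (z d 0) = (\<Sum>k<n. d * b k * partial_deriv k f (y \<theta> d k))"
      unfolding tele using \<theta> upd by (intro sum.cong) auto
    ultimately show ?thesis
      using that by (simp add: sum_divide_distrib)
  qed
  have "((\<lambda>d. (\<Sum>k<n. b k * partial_deriv k f (y \<theta> d k))) \<longlongrightarrow> (\<Sum>k<n. b k * partial_deriv k f x)) (at 0)"
  proof (intro tendsto_sum tendsto_mult tendsto_const)
    fix k assume "k \<in> {..<n}"
    then have k: "k < n" by simp
    show "((\<lambda>d. partial_deriv k f (y \<theta> d k)) \<longlongrightarrow> partial_deriv k f x) (at 0)"
      using cont[OF k] ylim[OF k] continuous_on_tendsto_compose[OF cont[OF k] ylim[OF k]] by simp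
  qed
  then show ?thesis
    unfolding DERIV_def x_def[symmetric]
    apply (rule Lim_transform_eventually)
    apply (auto simp: eventually_at_filter eq x_def)
    done
qed

text \<open>The derivative \<open>f'\<close> is carried along explicitly, and only derivatives along lines are required.
  In this form the class is easily seen to be closed under composition with \<open>arctan\<close>, linear
  combinations and products in separate variables, and linear changes of variables are immediate.\<close>

definition C1_bounded :: "nat \<Rightarrow> ((nat \<Rightarrow> real) \<Rightarrow> real) \<Rightarrow> (nat \<Rightarrow> (nat \<Rightarrow> real) \<Rightarrow> real) \<Rightarrow> bool" where
  "C1_bounded n f f' \<longleftrightarrow> continuous_on UNIV f \<and> bounded (range f) \<and>
     (\<forall>i<n. continuous_on UNIV (f' i) \<and> bounded (range (f' i))) \<and>
     (\<forall>a b \<epsilon>. ((\<lambda>\<epsilon>. f (\<lambda>i. a i + \<epsilon> * b i)) has_real_derivative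
        (\<Sum>i<n. b i * f' i (\<lambda>i. a i + \<epsilon> * b i))) (at \<epsilon>))"

lemma C1_boundedD:
  assumes "C1_bounded n f f'"
  shows "continuous_on UNIV f" "bounded (range f)"
    "\<And>i. i < n \<Longrightarrow> continuous_on UNIV (f' i)" "\<And>i. i < n \<Longrightarrow> bounded (range (f' i))"
    "\<And>a b \<epsilon>. ((\<lambda>\<epsilon>. f (\<lambda>i. a i + \<epsilon> * b i)) has_real_derivative
        (\<Sum>i<n. b i * f' i (\<lambda>i. a i + \<epsilon> * b i))) (at \<epsilon>)"
  using assms unfolding C1_bounded_def by blast+

lemma Cb_infinityD:
  assumes "f \<in> Cb_infinity n"
  shows "\<And>x y. (\<And>i. i < n \<Longrightarrow> x i = y i) \<Longrightarrow> f x = f y"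
    "bounded (range f)" "continuous_on UNIV f"
    "\<And>i. i < n \<Longrightarrow> \<forall>x. (\<lambda>s. f (x(i := s))) differentiable (at (x i))"
proof -
  from assms show "\<And>x y. (\<And>i. i < n \<Longrightarrow> x i = y i) \<Longrightarrow> f x = f y"
    by (simp add: Cb_infinity_def)
  from assms have *: "set is \<subseteq> {..<n} \<Longrightarrow> (let g = foldr partial_deriv is f in
           bounded (range g) \<and> continuous_on UNIV g \<and>
           (\<forall>i<n. \<forall>x. (\<lambda>s. g (x(i := s))) differentiable (at (x i))))" for "is"
    unfolding Cb_infinity_def by blast
  show "bounded (range f)" "continuous_on UNIV f"
    "\<And>i. i < n \<Longrightarrow> \<forall>x. (\<lambda>s. f (x(i := s))) differentiable (at (x i))"
    using *[of "[]"] by (auto simp: Let_def)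
qed

lemma Cb_infinity_partial_deriv:
  assumes f: "f \<in> Cb_infinity n" and i: "i < n"
  shows "partial_deriv i f \<in> Cb_infinity n"
  unfolding Cb_infinity_def
proof (intro CollectI conjI allI impI)
  fix x y :: "nat \<Rightarrow> real" assume "\<forall>i<n. x i = y i"
  then have "f (x(i := s)) = f (y(i := s))" for s
    by (intro Cb_infinityD(1)[OF f]) auto
  then show "partial_deriv i f x = partial_deriv i f y"
    using \<open>\<forall>i<n. x i = y i\<close> i by (simp add: partial_deriv_def)
next
  fix "is" :: "nat list" assume "set is \<subseteq> {..<n}"
  then have "set (is @ [i]) \<subseteq> {..<n}" using i by auto
  with f have "let g = foldr partial_deriv (is @ [i]) f in
           bounded (range g) \<and> continuous_on UNIV g \<and>
           (\<forall>i<n. \<forall>x. (\<lambda>s. g (x(i := s))) differentiable (at (x i)))"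
    unfolding Cb_infinity_def by blast
  then show "let g = foldr partial_deriv is (partial_deriv i f) in
           bounded (range g) \<and> continuous_on UNIV g \<and>
           (\<forall>i<n. \<forall>x. (\<lambda>s. g (x(i := s))) differentiable (at (x i)))"
    by simp
qed

lemma Cb_infinity_C1_bounded:
  assumes "f \<in> Cb_infinity n"
  shows "C1_bounded n f (\<lambda>i. partial_deriv i f)"
  unfolding C1_bounded_def
proof (intro conjI allI impI)
  note D = Cb_infinityD[OF assms] and P = Cb_infinity_partial_deriv[OF assms, THEN Cb_infinityD(3)]
  show "continuous_on UNIV f" "bounded (range f)" using D by blast+
  show "continuous_on UNIV (partial_deriv i f)" "bounded (range (partial_deriv i f))" if "i < n" for i
    using Cb_infinity_partial_deriv[OF assms that, THEN Cb_infinityD(3)]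
      Cb_infinity_partial_deriv[OF assms that, THEN Cb_infinityD(2)] by blast+
  show "((\<lambda>\<epsilon>. f (\<lambda>i. a i + \<epsilon> * b i)) has_real_derivative
        (\<Sum>i<n. b i * partial_deriv i f (\<lambda>i. a i + \<epsilon> * b i))) (at \<epsilon>)" for a b \<epsilon>
    by (rule has_derivative_along_line[OF D(1) D(4) P])
qed

lemma bounded_range_mult:
  fixes f g :: "'a \<Rightarrow> real"
  assumes "bounded (range f)" "bounded (range g)"
  shows "bounded (range (\<lambda>x. f x * g x))"
proof -
  from assms obtain A B where "\<And>x. \<bar>f x\<bar> \<le> A" "\<And>x. \<bar>g x\<bar> \<le> B"
    by (auto simp: bounded_iff)
  then have "\<bar>f x * g x\<bar> \<le> A * B" for x
    by (auto simp: abs_mult intro!: mult_mono order_trans[OF abs_ge_zero])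
  then show ?thesis by (auto simp: bounded_iff)
qed

lemma bounded_range_sum:
  fixes f :: "'i \<Rightarrow> 'a \<Rightarrow> real"
  assumes "finite I" "\<And>i. i \<in> I \<Longrightarrow> bounded (range (f i))"
  shows "bounded (range (\<lambda>x. \<Sum>i\<in>I. f i x))"
  using assms
proof (induction I rule: finite_induct)
  case (insert i I)
  then show ?case
    using bounded_plus_comp[of "f i" UNIV "\<lambda>x. \<Sum>i\<in>I. f i x"] by simp
qed (auto simp: bounded_iff)

lemma abs_arctan_le: "\<bar>arctan x\<bar> \<le> pi / 2"
  using arctan_bounded[of x] by linarith

lemma bounded_arctan: "bounded (range (\<lambda>x. arctan (f x)))"
  using abs_arctan_le by (auto simp: bounded_iff intro!: exI[of _ "pi / 2"])

lemma C1_bounded_arctan: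
  assumes "C1_bounded n f f'"
  shows "C1_bounded n (\<lambda>x. arctan (f x)) (\<lambda>i x. f' i x / (1 + (f x)\<^sup>2))"
  unfolding C1_bounded_def
proof (intro conjI allI impI)
  note D = C1_boundedD[OF assms]
  have pos: "1 + (f x)\<^sup>2 \<noteq> 0" for x
    using zero_le_power2[of "f x"] by linarith
  show "continuous_on UNIV (\<lambda>x. arctan (f x))"
    using D(1) by (intro continuous_intros)
  show "bounded (range (\<lambda>x. arctan (f x)))" by (rule bounded_arctan)
  show "continuous_on UNIV (\<lambda>x. f' i x / (1 + (f x)\<^sup>2))" if "i < n" for i
    using D(1) D(3)[OF that] pos by (intro continuous_intros) auto
  show "bounded (range (\<lambda>x. f' i x / (1 + (f x)\<^sup>2)))" if "i < n" for i
  proof -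
    have "bounded (range (\<lambda>x. f' i x * (1 / (1 + (f x)\<^sup>2))))"
    proof (rule bounded_range_mult[OF D(4)[OF that]])
      have "\<bar>1 / (1 + (f x)\<^sup>2)\<bar> \<le> 1" for x
        using zero_le_power2[of "f x"] pos[of x] by (simp add: abs_le_iff divide_le_eq_1 add_nonneg_pos less_le)
      then show "bounded (range (\<lambda>x. 1 / (1 + (f x)\<^sup>2)))"
        by (auto simp: bounded_iff)
    qed
    then show ?thesis by simp
  qed
  show "((\<lambda>\<epsilon>. arctan (f (\<lambda>i. a i + \<epsilon> * b i))) has_real_derivative
       (\<Sum>i<n. b i * (f' i (\<lambda>i. a i + \<epsilon> * b i) / (1 + (f (\<lambda>i. a i + \<epsilon> * b i))\<^sup>2)))) (at \<epsilon>)"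
    for a b \<epsilon>
    using pos by (auto intro!: derivative_eq_intros D(5) simp: sum_distrib_left divide_inverse mult_ac sum_distrib_right)
qed

lemma C1_bounded_lincomb:
  fixes m :: nat
  assumes "\<And>j. j < m \<Longrightarrow> C1_bounded n (g j) (g' j)"
  shows "C1_bounded n (\<lambda>x. \<Sum>j<m. c j * g j x) (\<lambda>i x. \<Sum>j<m. c j * g' j i x)"
  unfolding C1_bounded_def
proof (intro conjI allI impI)
  note D = C1_boundedD[OF assms]
  have cst: "bounded (range (\<lambda>_. c))" for c :: real
    by (auto simp: bounded_iff)
  show "continuous_on UNIV (\<lambda>x. \<Sum>j<m. c j * g j x)"
    using D(1) by (intro continuous_intros) auto
  show "bounded (range (\<lambda>x. \<Sum>j<m. c j * g j x))"
    using D(2) by (intro bounded_range_sum bounded_range_mult cst finite_lessThan) auto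
  show "continuous_on UNIV (\<lambda>x. \<Sum>j<m. c j * g' j i x)" if "i < n" for i
    using D(3) that by (intro continuous_intros) auto
  show "bounded (range (\<lambda>x. \<Sum>j<m. c j * g' j i x))" if "i < n" for i
    using D(4) that by (intro bounded_range_sum bounded_range_mult cst finite_lessThan) auto
  have eq: "(\<Sum>i<n. b i * (\<Sum>j<m. c j * g' j i z)) = (\<Sum>j<m. c j * (\<Sum>i<n. b i * g' j i z))" for b z
    unfolding sum_distrib_left by (subst sum.swap) (simp add: mult_ac)
  show "((\<lambda>\<epsilon>. \<Sum>j<m. c j * g j (\<lambda>i. a i + \<epsilon> * b i)) has_real_derivative
        (\<Sum>i<n. b i * (\<Sum>j<m. c j * g' j i (\<lambda>i. a i + \<epsilon> * b i)))) (at \<epsilon>)" for a b \<epsilon>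
    unfolding eq
    by (rule DERIV_sum) (auto intro!: DERIV_cmult D(5))
qed

lemma sum_lessThan_add_split:
  fixes m n :: nat
  shows "(\<Sum>i<n+m. F i) = (\<Sum>i<n. F i) + (\<Sum>i<m. F (n + i) :: real)"
  by (induction m) auto

text \<open>The two factors use disjoint blocks of coordinates, so that functions of the path at two
  unrelated sets of times multiply to a function of the path at the concatenated times.\<close>

lemma C1_bounded_mult:
  assumes "C1_bounded n f f'" "C1_bounded m g g'"
  shows "C1_bounded (n + m) (\<lambda>x. f x * g (\<lambda>i. x (n + i)))
    (\<lambda>i x. if i < n then f' i x * g (\<lambda>i. x (n + i)) else f x * g' (i - n) (\<lambda>i. x (n + i)))"
  unfolding C1_bounded_def
proof (intro conjI allI impI)
  note D = C1_boundedD[OF assms(1)] and E = C1_boundedD[OF assms(2)]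
  have sh: "continuous_on UNIV (\<lambda>(x::nat \<Rightarrow> real) i. x (n + i))"
    by (intro continuous_on_coordinatewise_then_product continuous_on_product_coordinates)
  have shc: "continuous_on UNIV (\<lambda>x. k (\<lambda>i. x (n + i)))" if "continuous_on UNIV k" for k :: "(nat \<Rightarrow> real) \<Rightarrow> real"
    by (rule continuous_on_compose2[OF that sh]) auto
  have shb: "bounded (range (\<lambda>x. k (\<lambda>i. x (n + i))))" if "bounded (range k)" for k :: "(nat \<Rightarrow> real) \<Rightarrow> real"
    by (rule bounded_subset[OF that]) auto
  show "continuous_on UNIV (\<lambda>x. f x * g (\<lambda>i. x (n + i)))"
    using D(1) E(1) by (intro continuous_intros shc) auto
  show "bounded (range (\<lambda>x. f x * g (\<lambda>i. x (n + i))))"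
    using D(2) E(2) by (intro bounded_range_mult shb) auto
  show "continuous_on UNIV (\<lambda>x. if i < n then f' i x * g (\<lambda>i. x (n + i))
         else f x * g' (i - n) (\<lambda>i. x (n + i)))" if "i < n + m" for i
    using D E that by (cases "i < n") (auto intro!: continuous_intros shc)
  show "bounded (range (\<lambda>x. if i < n then f' i x * g (\<lambda>i. x (n + i))
         else f x * g' (i - n) (\<lambda>i. x (n + i))))" if "i < n + m" for i
    using D E that by (cases "i < n") (auto intro!: bounded_range_mult shb)
  show "((\<lambda>\<epsilon>. f (\<lambda>i. a i + \<epsilon> * b i) * g (\<lambda>i. a (n + i) + \<epsilon> * b (n + i))) has_real_derivative
     (\<Sum>i<n+m. b i * (if i < n then f' i (\<lambda>i. a i + \<epsilon> * b i) * g (\<lambda>i. a (n + i) + \<epsilon> * b (n + i))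
        else f (\<lambda>i. a i + \<epsilon> * b i) * g' (i - n) (\<lambda>i. a (n + i) + \<epsilon> * b (n + i))))) (at \<epsilon>)" for a b \<epsilon>
    unfolding sum_lessThan_add_split
    by (rule derivative_eq_intros D(5) E(5) refl)+
       (simp add: sum_distrib_left sum_distrib_right mult_ac)
qed

section \<open>Gaussian integration by parts\<close>

lemma normal_density_tendsto_0:
  assumes "\<sigma> > 0"
  shows "((normal_density 0 \<sigma>) \<longlongrightarrow> 0) at_top" "((normal_density 0 \<sigma>) \<longlongrightarrow> 0) at_bot"
proof -
  have c: "1 / (2 * \<sigma>\<^sup>2) > 0" using assms by simp
  have *: "((\<lambda>x::real. exp (- (1 / (2 * \<sigma>\<^sup>2) * x\<^sup>2))) \<longlongrightarrow> 0) F"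
    if "filterlim (\<lambda>x::real. x\<^sup>2) at_top F" for F
  proof -
    have "filterlim (\<lambda>x::real. 1 / (2 * \<sigma>\<^sup>2) * x\<^sup>2) at_top F"
      by (rule filterlim_tendsto_pos_mult_at_top[OF tendsto_const c that])
    then have "filterlim (\<lambda>x::real. - (1 / (2 * \<sigma>\<^sup>2) * x\<^sup>2)) at_bot F"
      by (simp add: filterlim_uminus_at_top)
    then show ?thesis by (rule filterlim_compose[OF exp_at_bot])
  qed
  have eq: "normal_density 0 \<sigma> = (\<lambda>x. 1 / sqrt (2 * pi * \<sigma>\<^sup>2) * exp (- (1 / (2 * \<sigma>\<^sup>2) * x\<^sup>2)))"
    by (rule ext) (simp add: normal_density_def)
  have sq: "filterlim (\<lambda>x::real. x\<^sup>2) at_top at_top" "filterlim (\<lambda>x::real. x\<^sup>2) at_top at_bot"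
    by (rule filterlim_pow_at_top[OF _ filterlim_ident], simp)
       (rule filterlim_pow_at_bot_even[OF _ filterlim_ident], simp_all)
  show "((normal_density 0 \<sigma>) \<longlongrightarrow> 0) at_top" "((normal_density 0 \<sigma>) \<longlongrightarrow> 0) at_bot"
    unfolding eq by (intro tendsto_mult_right_zero * sq)+
qed

text \<open>The two sides differ by the integral of the derivative of \<open>u y * normal_density 0 \<sigma> y\<close>, which
  vanishes at both ends of the line.\<close>

lemma normal_stein:
  assumes \<sigma>: "\<sigma> > 0"
    and der: "\<And>y. (u has_real_derivative u' y) (at y)"
    and cont: "continuous_on UNIV u'"
    and A: "\<And>y. \<bar>u y\<bar> \<le> A" and B: "\<And>y. \<bar>u' y\<bar> \<le> B"
  shows "(\<integral>y. normal_density 0 \<sigma> y * u' y \<partial>lborel) = (\<integral>y. normal_density 0 \<sigma> y * (u y * y) \<partial>lborel) / \<sigma>\<^sup>2"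
proof -
  let ?\<phi> = "normal_density 0 \<sigma>"
  have contu: "continuous_on UNIV u"
    using der by (meson DERIV_isCont continuous_at_imp_continuous_on)
  have [measurable]: "u \<in> borel_measurable borel" "u' \<in> borel_measurable borel"
    using contu cont by (auto intro: borel_measurable_continuous_onI)
  have d\<phi>: "(?\<phi> has_real_derivative - (y / \<sigma>\<^sup>2) * ?\<phi> y) (at y)" for y
    unfolding normal_density_def using \<sigma>
    by (auto intro!: derivative_eq_intros simp: field_simps power2_eq_square)
  have int1: "integrable lborel (\<lambda>y. ?\<phi> y * u' y)"
    by (rule Bochner_Integration.integrable_bound[OF integrable_mult_right[OF integrable_normal_density[OF \<sigma>], of B]])
       (auto simp: abs_mult mult.commute intro!: always_eventually mult_mono order_trans[OF B] order_trans[OF abs_ge_zero B])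
  have int2: "integrable lborel (\<lambda>y. ?\<phi> y * (u y * y))"
    by (rule Bochner_Integration.integrable_bound[OF integrable_mult_right[OF integrable_normal_moment_abs[OF \<sigma>, of 0 1], of A]])
       (auto simp: abs_mult mult_ac intro!: always_eventually mult_left_mono mult_right_mono A order_trans[OF A abs_ge_self])
  let ?f = "\<lambda>y. ?\<phi> y * u' y - (?\<phi> y * (u y * y)) / \<sigma>\<^sup>2"
  have "(LBINT y=-\<infinity>..\<infinity>. ?f y) = 0 - 0"
  proof (rule interval_integral_FTC_integrable)
    show "((\<lambda>y. u y * ?\<phi> y) has_vector_derivative ?f y) (at y)" for y
      unfolding has_real_derivative_iff_has_vector_derivative[symmetric]
      by (rule derivative_eq_intros der d\<phi> refl)+ (simp add: field_simps)
    have "continuous_on UNIV ?\<phi>"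
      using d\<phi> by (meson DERIV_isCont continuous_at_imp_continuous_on)
    then have "continuous_on UNIV ?f"
      using cont contu \<sigma> by (auto intro!: continuous_intros)
    then show "isCont ?f y" for y
      by (simp add: continuous_on_eq_continuous_at)
    show "set_integrable lborel (einterval (-\<infinity>) \<infinity>) ?f"
      using int1 int2 by (auto simp: einterval_def set_integrable_def)
    have lim: "((\<lambda>y. u y * ?\<phi> y) \<longlongrightarrow> 0) F" if "(?\<phi> \<longlongrightarrow> 0) F" for F
      by (rule tendsto_0_le[OF that, of _ A])
         (auto intro!: always_eventually mult_right_mono A simp: abs_mult mult.commute)
    show "(((\<lambda>y. u y * ?\<phi> y) \<circ> real_of_ereal) \<longlongrightarrow> 0) (at_right (-\<infinity>))"
      "(((\<lambda>y. u y * ?\<phi> y) \<circ> real_of_ereal) \<longlongrightarrow> 0) (at_left \<infinity>)"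
      using lim normal_density_tendsto_0[OF \<sigma>] by (simp_all add: ereal_tendsto_simps)
  qed simp
  then have "(\<integral>y. ?f y \<partial>lborel) = 0"
    by (simp add: interval_lebesgue_integral_def set_lebesgue_integral_def einterval_def)
  then show ?thesis
    using int1 int2 by simp
qed

lemma (in prob_space) normal_integrable_power:
  assumes "distributed M lborel X (normal_density 0 \<sigma>)" "\<sigma> > 0"
  shows "integrable M (\<lambda>\<omega>. X \<omega> ^ k)" "integrable M (\<lambda>\<omega>. \<bar>X \<omega>\<bar> ^ k)"
  using distributed_integrable[OF assms(1), of "\<lambda>x. x ^ k"] integrable_normal_moment[OF assms(2), of 0 k]
    distributed_integrable[OF assms(1), of "\<lambda>x. \<bar>x\<bar> ^ k"] integrable_normal_moment_abs[OF assms(2), of 0 k]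
  by simp_all

lemma (in prob_space) normal_moments:
  assumes "distributed M lborel X (normal_density 0 \<sigma>)" "\<sigma> > 0"
  shows "expectation X = 0" "expectation (\<lambda>\<omega>. X \<omega> ^ 2) = \<sigma>\<^sup>2" "expectation (\<lambda>\<omega>. X \<omega> ^ 4) = 3 * \<sigma> ^ 4"
  using distributed_integral[OF assms(1), of "\<lambda>x. x"] has_bochner_integral_integral_eq[OF normal_moment_odd[OF assms(2), of 0 0]]
    distributed_integral[OF assms(1), of "\<lambda>x. x^2"] has_bochner_integral_integral_eq[OF normal_moment_even[OF assms(2), of 0 1]]
    distributed_integral[OF assms(1), of "\<lambda>x. x^4"] has_bochner_integral_integral_eq[OF normal_moment_even[OF assms(2), of 0 2]]
  by (simp_all add: fact_numeral power2_eq_square power4_eq_xxxx)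

text \<open>By independence the law of the family is a product measure, in which the coordinate \<open>k\<close> can be
  integrated first; that inner integral is the one-dimensional formula.\<close>

lemma (in prob_space) gaussian_ibp_coordinate:
  fixes g :: "(nat \<Rightarrow> real) \<Rightarrow> real"
  assumes I: "finite I" "k \<in> I"
    and ind: "indep_vars (\<lambda>_. borel) X I"
    and X: "distributed M lborel (X k) (normal_density 0 \<sigma>)" and \<sigma>: "\<sigma> > 0"
    and cont: "continuous_on UNIV g" "continuous_on UNIV g'"
    and bdd: "bounded (range g)" "bounded (range g')"
    and der: "\<And>x s. ((\<lambda>s. g (x(k := s))) has_real_derivative g' (x(k := s))) (at s)"
  shows "expectation (\<lambda>\<omega>. g' (\<lambda>i\<in>I. X i \<omega>)) = expectation (\<lambda>\<omega>. g (\<lambda>i\<in>I. X i \<omega>) * X k \<omega>) / \<sigma>\<^sup>2"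
proof -
  obtain A B where A: "\<And>x. \<bar>g x\<bar> \<le> A" and B: "\<And>x. \<bar>g' x\<bar> \<le> B"
    using bdd by (auto simp: bounded_iff)
  define J where "J = I - {k}"
  have J: "finite J" "k \<notin> J" "insert k J = I" using I by (auto simp: J_def)
  have rv[measurable]: "X i \<in> borel_measurable M" if "i \<in> I" for i
    using ind that by (auto simp: indep_vars_def)
  let ?D = "\<lambda>i. if i \<in> I then distr M borel (X i) else return borel 0"
  let ?P = "PiM I ?D"
  have ps: "prob_space (?D i)" for i
    using rv[of i] by (cases "i \<in> I") (simp_all add: prob_space_distr prob_space_return)
  interpret D: product_prob_space ?D I
    by (rule product_prob_spaceI) (rule ps)
  have sets: "sets ?P = sets (PiM I (\<lambda>_. borel))"
    by (intro sets_PiM_cong) auto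
  have distr: "distr M (PiM I (\<lambda>_. borel)) (\<lambda>\<omega>. \<lambda>i\<in>I. X i \<omega>) = ?P"
  proof -
    have "I \<noteq> {}" using I by auto
    then have "distr M (PiM I (\<lambda>_. borel)) (\<lambda>\<omega>. \<lambda>i\<in>I. X i \<omega>) = PiM I (\<lambda>i. distr M borel (X i))"
      using indep_vars_iff_distr_eq_PiM'[of I X "\<lambda>_. borel"] ind rv by simp
    also have "\<dots> = ?P" by (intro PiM_cong) auto
    finally show ?thesis .
  qed
  have X': "(\<lambda>\<omega>. \<lambda>i\<in>I. X i \<omega>) \<in> measurable M (PiM I (\<lambda>_. borel))"
    by (intro measurable_restrict rv)
  have meas: "f \<in> borel_measurable (PiM I (\<lambda>_. borel))" if "continuous_on UNIV f" for f :: "(nat \<Rightarrow> real) \<Rightarrow> real"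
  proof -
    have "(\<lambda>x. x) \<in> measurable (PiM I (\<lambda>_. borel :: real measure)) borel"
    proof (rule measurable_coordinatewise_then_product)
      fix i show "(\<lambda>x. x i) \<in> borel_measurable (PiM I (\<lambda>_. borel :: real measure))"
      proof (cases "i \<in> I")
        case False
        then have "(\<lambda>x. x i) \<in> borel_measurable (PiM I (\<lambda>_. borel :: real measure)) \<longleftrightarrow>
          (\<lambda>x. undefined :: real) \<in> borel_measurable (PiM I (\<lambda>_. borel :: real measure))"
          by (intro measurable_cong) (auto simp: space_PiM PiE_def extensional_def)
        then show ?thesis by simp
      qed simp
    qed
    then show ?thesis
      using measurable_comp[OF _ borel_measurable_continuous_onI[OF that]] by (auto simp: comp_def)
  qed
  have mg[measurable]: "g \<in> borel_measurable ?P" "g' \<in> borel_measurable ?P"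
    "(\<lambda>x. x k) \<in> borel_measurable ?P"
    using meas[OF cont(1)] meas[OF cont(2)] I(2) by (simp_all add: measurable_cong_sets[OF sets refl])
  have Xk: "integrable M (\<lambda>\<omega>. \<bar>X k \<omega>\<bar>)"
    using normal_integrable_power(2)[OF X \<sigma>, of 1] by simp
  have mc: "f \<in> borel_measurable (PiM I (\<lambda>_. borel)) \<longleftrightarrow> f \<in> borel_measurable ?P" for f :: "_ \<Rightarrow> real"
    by (simp add: measurable_cong_sets[OF sets refl])
  have "integrable M (\<lambda>\<omega>. g (\<lambda>i\<in>I. X i \<omega>) * X k \<omega>)"
    using A I by (intro Bochner_Integration.integrable_bound[OF integrable_mult_right[OF Xk, of A]])
       (auto intro!: always_eventually mult_mono borel_measurable_times measurable_compose[OF X' meas[OF cont(1)]]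
             simp: abs_mult order_trans[OF A abs_ge_self] order_trans[OF abs_ge_zero A])
  then have int2: "integrable ?P (\<lambda>x. g x * x k)"
    unfolding distr[symmetric] using I
    by (subst integrable_distr_eq[OF X']) (auto simp: mc)
  have int1: "integrable ?P g'"
    using B by (intro D.P.integrable_const_bound[of _ B]) auto
  have dX: "distr M borel (X k) = density lborel (\<lambda>x. ennreal (normal_density 0 \<sigma> x))"
    using distributed_distr_eq_density[OF X] by (simp cong: distr_cong)
  have cu: "continuous_on UNIV (\<lambda>y. x(k := y))" for x :: "nat \<Rightarrow> real"
  proof (rule continuous_on_coordinatewise_then_product)
    show "continuous_on UNIV (\<lambda>y. (x(k := y)) i)" for i
      by (cases "i = k") auto
  qed
  have mu: "(\<lambda>y. f (x(k := y))) \<in> borel_measurable borel" if "continuous_on UNIV f" for f :: "(nat \<Rightarrow> real) \<Rightarrow> real" and x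
  proof -
    show ?thesis
      by (intro borel_measurable_continuous_onI continuous_on_compose2[OF that cu]) auto
  qed
  have inner: "(\<integral>y. g' (x(k := y)) \<partial>?D k) = (\<integral>y. g (x(k := y)) * (x(k := y)) k \<partial>?D k) / \<sigma>\<^sup>2" for x
  proof -
    have "(\<integral>y. normal_density 0 \<sigma> y * g' (x(k := y)) \<partial>lborel) =
       (\<integral>y. normal_density 0 \<sigma> y * (g (x(k := y)) * y) \<partial>lborel) / \<sigma>\<^sup>2"
      by (rule normal_stein[OF \<sigma> der]) (auto intro!: A B continuous_on_compose2[OF cont(2) cu])
    then show ?thesis
      using I mu[OF cont(1), of x] mu[OF cont(2), of x] by (simp add: dX integral_real_density)
  qed
  have ins: "integral\<^sup>L ?P f = (\<integral>x. (\<integral>y. f (x(k := y)) \<partial>?D k) \<partial>PiM J ?D)" if "integrable ?P f" for f :: "_ \<Rightarrow> real"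
    using D.product_integral_insert[OF J(1,2), of f] that unfolding J(3) by simp
  have "expectation (\<lambda>\<omega>. g' (\<lambda>i\<in>I. X i \<omega>)) = integral\<^sup>L ?P g'"
    unfolding distr[symmetric] by (rule integral_distr[symmetric, OF X' meas[OF cont(2)]])
  also have "\<dots> = (\<integral>x. (\<integral>y. g (x(k := y)) * (x(k := y)) k \<partial>?D k) / \<sigma>\<^sup>2 \<partial>PiM J ?D)"
    unfolding ins[OF int1] inner ..
  also have "\<dots> = integral\<^sup>L ?P (\<lambda>x. g x * x k) / \<sigma>\<^sup>2"
    unfolding ins[OF int2] by simp
  also have "integral\<^sup>L ?P (\<lambda>x. g x * x k) = expectation (\<lambda>\<omega>. g (\<lambda>i\<in>I. X i \<omega>) * X k \<omega>)"
    unfolding distr[symmetric] using I by (subst integral_distr[OF X']) (auto simp: mc)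
  finally show ?thesis .
qed

section \<open>Cameron--Martin directions\<close>

text \<open>Cameron--Martin functions described through their increments instead of the derivative: \<open>H t\<close>
  stands for the energy \<open>\<integral>\<bar>h'\<bar>\<^sup>2\<close> on \<open>[0, t]\<close> and \<open>K\<close> for a bound on the total energy. The last
  condition is the Cauchy--Schwarz inequality on \<open>[s, t]\<close>.\<close>

definition finite_energy :: "(real \<Rightarrow> real) \<Rightarrow> (real \<Rightarrow> real) \<Rightarrow> real \<Rightarrow> bool" where
  "finite_energy h H K \<longleftrightarrow> (\<forall>t\<le>0. h t = 0) \<and> (\<forall>t\<ge>0. 0 \<le> H t \<and> H t \<le> K) \<and>
     (\<forall>s t. 0 \<le> s \<longrightarrow> s \<le> t \<longrightarrow> (h t - h s)\<^sup>2 \<le> (t - s) * (H t - H s))"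

text \<open>The integral of \<open>(f - c)\<^sup>2\<close> is nonnegative; taking for \<open>c\<close> the mean of \<open>f\<close> gives the bound.\<close>

lemma set_integral_square_le:
  fixes f :: "real \<Rightarrow> real"
  assumes "s \<le> t" and f: "set_integrable lborel {s<..t} f"
    and f2: "set_integrable lborel {s<..t} (\<lambda>x. (f x)\<^sup>2)"
  shows "(LBINT x:{s<..t}. f x)\<^sup>2 \<le> (t - s) * (LBINT x:{s<..t}. (f x)\<^sup>2)"
proof (cases "s = t")
  case False
  with assms have L: "t - s > 0" by simp
  define I where "I = (LBINT x:{s<..t}. f x)"
  define J where "J = (LBINT x:{s<..t}. (f x)\<^sup>2)"
  define c where "c = I / (t - s)"
  have cst: "set_integrable lborel {s<..t} (\<lambda>x. c\<^sup>2)"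
    using assms(1) by (auto simp: set_integrable_def intro!: integrable_real_indicator)
  have lin: "set_integrable lborel {s<..t} (\<lambda>x. 2 * c * f x)"
    using f by (rule set_integrable_mult_right)
  have "0 \<le> (LBINT x:{s<..t}. (f x)\<^sup>2 - 2 * c * f x + c\<^sup>2)"
    unfolding set_lebesgue_integral_def
  proof (rule Bochner_Integration.integral_nonneg)
    fix x
    have "(f x)\<^sup>2 - 2 * c * f x + c\<^sup>2 = (f x - c)\<^sup>2"
      by (simp add: power2_eq_square algebra_simps)
    then show "0 \<le> indicator {s<..t} x *\<^sub>R ((f x)\<^sup>2 - 2 * c * f x + c\<^sup>2)" by simp
  qed
  also have "(LBINT x:{s<..t}. (f x)\<^sup>2 - 2 * c * f x + c\<^sup>2) = J - 2 * c * I + (t - s) * c\<^sup>2"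
    using f f2 cst lin L
    by (simp add: set_integral_add set_integral_diff I_def J_def set_integral_mult_right set_lebesgue_integral_def[of _ _ "\<lambda>_. c\<^sup>2"])
  also have "\<dots> = J - I\<^sup>2 / (t - s)"
  proof -
    have "J - 2 * (I / L) * I + L * (I / L)\<^sup>2 = J - I\<^sup>2 / L" if "L > 0" for L
      using that by (simp add: field_simps power2_eq_square)
    from this[OF L] show ?thesis by (simp add: c_def)
  qed
  finally have "I\<^sup>2 \<le> (t - s) * J"
    using L by (simp add: field_simps)
  then show ?thesis by (simp add: I_def J_def)
qed (simp add: set_lebesgue_integral_def)

lemma cameron_martin_finite_energy:
  assumes "h \<in> cameron_martin"
  obtains H K where "finite_energy h H K"
proof -
  from assms obtain h' where meas: "set_borel_measurable lborel {0..} h'"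
    and sq: "set_integrable lborel {0..} (\<lambda>s. (h' s)\<^sup>2)"
    and h: "\<And>t. t \<ge> 0 \<Longrightarrow> h t = (LBINT s:{0..t}. h' s)" and neg: "\<And>t. t < 0 \<Longrightarrow> h t = 0"
    unfolding cameron_martin_def by blast
  have sqA: "set_integrable lborel A (\<lambda>s. (h' s)\<^sup>2)" if "A \<in> sets lborel" "A \<subseteq> {0..}" for A
    by (rule set_integrable_subset[OF sq that])
  have intA: "set_integrable lborel A h'" if A: "A \<in> sets lborel" "A \<subseteq> {0..t}" for A t
  proof -
    have "set_integrable lborel A (\<lambda>s. 1 + (h' s)\<^sup>2)"
    proof (rule set_integral_add)
      show "set_integrable lborel A (\<lambda>s. 1 :: real)"
        by (rule set_integrable_subset[OF _ A]) (auto simp: set_integrable_def emeasure_lborel_Icc_eq intro!: integrable_real_indicator)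
      show "set_integrable lborel A (\<lambda>s. (h' s)\<^sup>2)"
        by (rule sqA[OF A(1)]) (use A(2) in auto)
    qed
    then show ?thesis
    proof (rule set_integrable_bound)
      show "set_borel_measurable lborel A h'"
        by (rule set_borel_measurable_subset[OF meas A(1)]) (use A(2) in auto)
      have "\<bar>y\<bar> \<le> 1 + y\<^sup>2" for y :: real
      proof -
        have "0 \<le> (\<bar>y\<bar> - 1)\<^sup>2" by simp
        then have "2 * \<bar>y\<bar> \<le> 1 + y\<^sup>2" by (simp add: power2_diff)
        then show ?thesis by linarith
      qed
      then show "AE x in lborel. x \<in> A \<longrightarrow> norm (h' x) \<le> norm (1 + (h' x)\<^sup>2)"
        by (auto intro!: always_eventually simp: order_trans[OF _ abs_ge_self])
    qed
  qed
  define H where "H t = (LBINT s:{0..t}. (h' s)\<^sup>2)" for t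
  define K where "K = (LBINT s:{0..}. (h' s)\<^sup>2)"
  have split: "{0..t} = {0..s} \<union> {s<..t}" if "0 \<le> s" "s \<le> t" for s t :: real
    using that by auto
  have "finite_energy h H K"
    unfolding finite_energy_def
  proof (intro conjI allI impI)
    fix t :: real assume "t \<le> 0"
    then consider "t < 0" | "t = 0" by linarith
    then show "h t = 0"
    proof cases
      case 2
      have "AE x in lborel. indicator {0} x *\<^sub>R h' x = 0"
        using AE_lborel_singleton[of 0] by eventually_elim auto
      then have "(LBINT s:{0..0}. h' s) = 0"
        unfolding set_lebesgue_integral_def by (simp add: integral_eq_zero_AE)
      with 2 show ?thesis by (simp add: h)
    qed (simp add: neg)
  next
    fix t :: real assume t: "t \<ge> 0"
    show "0 \<le> H t"
      unfolding H_def set_lebesgue_integral_def by (rule Bochner_Integration.integral_nonneg) simp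
    have "set_integrable lborel {0..t} (\<lambda>s. (h' s)\<^sup>2)" by (rule sqA) auto
    then show "H t \<le> K"
      unfolding H_def K_def set_lebesgue_integral_def using sq
      by (intro integral_mono) (auto simp: set_integrable_def indicator_def)
  next
    fix s t :: real assume st: "0 \<le> s" "s \<le> t"
    have 1: "h t - h s = (LBINT x:{s<..t}. h' x)"
    proof -
      have "h t = (LBINT x:{0..s} \<union> {s<..t}. h' x)"
        using st h[of t] split[OF st] by simp
      also have "\<dots> = (LBINT x:{0..s}. h' x) + (LBINT x:{s<..t}. h' x)"
        by (rule set_integral_Un) (use st in \<open>auto intro!: intA[of _ t]\<close>)
      finally show ?thesis using h[of s] st by simp
    qed
    have 2: "H t - H s = (LBINT x:{s<..t}. (h' x)\<^sup>2)"
      using st unfolding H_def split[OF st]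
      by (subst set_integral_Un) (auto intro!: sqA)
    show "(h t - h s)\<^sup>2 \<le> (t - s) * (H t - H s)"
      unfolding 1 2 by (rule set_integral_square_le) (use st in \<open>auto intro!: intA[of _ t] sqA\<close>)
  qed
  then show thesis by (rule that)
qed

lemma finite_energyD:
  assumes "finite_energy h H K"
  shows "\<And>t. t \<le> 0 \<Longrightarrow> h t = 0" "\<And>t. 0 \<le> t \<Longrightarrow> 0 \<le> H t" "\<And>t. 0 \<le> t \<Longrightarrow> H t \<le> K"
    "\<And>s t. 0 \<le> s \<Longrightarrow> s \<le> t \<Longrightarrow> (h t - h s)\<^sup>2 \<le> (t - s) * (H t - H s)" "0 \<le> K"
proof -
  from assms show *: "\<And>t. t \<le> 0 \<Longrightarrow> h t = 0" "\<And>t. 0 \<le> t \<Longrightarrow> 0 \<le> H t" "\<And>t. 0 \<le> t \<Longrightarrow> H t \<le> K"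
    "\<And>s t. 0 \<le> s \<Longrightarrow> s \<le> t \<Longrightarrow> (h t - h s)\<^sup>2 \<le> (t - s) * (H t - H s)"
    unfolding finite_energy_def by blast+
  from *(2,3)[of 0] show "0 \<le> K" by simp
qed

lemma finite_energy_growth:
  assumes "finite_energy h H K" "0 \<le> t"
  shows "\<bar>h t\<bar> \<le> sqrt K * sqrt t"
proof -
  note D = finite_energyD[OF assms(1)]
  have "(h t)\<^sup>2 \<le> t * (H t - H 0)"
    using D(4)[of 0 t] D(1)[of 0] assms(2) by simp
  also have "\<dots> \<le> t * K"
    using D(2)[of 0] D(3)[of t] assms(2) by (intro mult_left_mono) auto
  finally have "sqrt ((h t)\<^sup>2) \<le> sqrt (t * K)" by (rule real_sqrt_le_mono)
  then show ?thesis by (simp add: real_sqrt_mult mult.commute)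
qed

lemma finite_energy_continuous:
  assumes "finite_energy h H K"
  shows "continuous_on UNIV h"
proof -
  note D = finite_energyD[OF assms]
  have 1: "\<bar>h t - h s\<bar> \<le> sqrt K * sqrt (t - s)" if "0 \<le> s" "s \<le> t" for s t
  proof -
    have "(h t - h s)\<^sup>2 \<le> (t - s) * (H t - H s)" using D(4) that by blast
    also have "\<dots> \<le> (t - s) * K"
      using D(2)[of s] D(3)[of t] that by (intro mult_left_mono) auto
    finally have "sqrt ((h t - h s)\<^sup>2) \<le> sqrt ((t - s) * K)" by (rule real_sqrt_le_mono)
    then show ?thesis by (simp add: real_sqrt_mult mult.commute)
  qed
  have 3: "\<bar>h b - h a\<bar> \<le> sqrt K * sqrt \<bar>b - a\<bar>" if "0 \<le> a" "0 \<le> b" for a b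
    using 1[of a b] 1[of b a] that by (cases "a \<le> b") (simp_all add: abs_minus_commute[of "h b"])
  have 2: "\<bar>h t - h s\<bar> \<le> sqrt K * sqrt \<bar>t - s\<bar>" for s t
  proof -
    have "\<bar>h t - h s\<bar> = \<bar>h (max 0 t) - h (max 0 s)\<bar>"
      using D(1)[of t] D(1)[of s] D(1)[of 0] by (simp add: max_def)
    also have "\<dots> \<le> sqrt K * sqrt \<bar>max 0 t - max 0 s\<bar>"
      by (rule 3) auto
    also have "\<dots> \<le> sqrt K * sqrt \<bar>t - s\<bar>"
      using D(5) by (intro mult_left_mono real_sqrt_le_mono) auto
    finally show ?thesis .
  qed
  have "(h \<longlongrightarrow> h s) (at s)" for s
  proof (rule LIM_zero_cancel, rule tendsto_0_le[of "\<lambda>t. sqrt K * sqrt \<bar>t - s\<bar>" _ _ 1])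
    have "((\<lambda>t. sqrt K * sqrt \<bar>t - s\<bar>) \<longlongrightarrow> sqrt K * sqrt \<bar>s - s\<bar>) (at s)"
      by (intro tendsto_intros)
    then show "((\<lambda>t. sqrt K * sqrt \<bar>t - s\<bar>) \<longlongrightarrow> 0) (at s)" by simp
    show "\<forall>\<^sub>F t in at s. norm (h t - h s) \<le> norm (sqrt K * sqrt \<bar>t - s\<bar>) * 1"
      using 2 D(5) by (auto intro!: always_eventually)
  qed
  then show ?thesis
    by (simp add: continuous_on_eq_continuous_at isCont_def)
qed

section \<open>Integration by parts on Wiener space\<close>

lemma (in prob_space) indep_vars_sum_square:
  fixes Y :: "'i \<Rightarrow> 'a \<Rightarrow> real"
  assumes I: "finite I" and ind: "indep_vars (\<lambda>_. borel) Y I"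
    and int: "\<And>i. i \<in> I \<Longrightarrow> integrable M (Y i)" and int2: "\<And>i. i \<in> I \<Longrightarrow> integrable M (\<lambda>\<omega>. (Y i \<omega>)\<^sup>2)"
    and zero: "\<And>i. i \<in> I \<Longrightarrow> expectation (Y i) = 0"
  shows "integrable M (\<lambda>\<omega>. (\<Sum>i\<in>I. Y i \<omega>)\<^sup>2)"
    and "expectation (\<lambda>\<omega>. (\<Sum>i\<in>I. Y i \<omega>)\<^sup>2) = (\<Sum>i\<in>I. expectation (\<lambda>\<omega>. (Y i \<omega>)\<^sup>2))"
proof -
  have sq: "(\<Sum>i\<in>I. Y i \<omega>)\<^sup>2 = (\<Sum>i\<in>I. \<Sum>j\<in>I. Y i \<omega> * Y j \<omega>)" for \<omega>
    by (simp add: power2_eq_square sum_product)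
  have off: "integrable M (\<lambda>\<omega>. Y i \<omega> * Y j \<omega>) \<and> expectation (\<lambda>\<omega>. Y i \<omega> * Y j \<omega>) = 0"
    if "i \<in> I" "j \<in> I" "i \<noteq> j" for i j
  proof -
    have ij: "indep_vars (\<lambda>_. borel) Y {i, j}"
      by (rule indep_vars_subset[OF ind]) (use that in auto)
    have "integrable M (\<lambda>\<omega>. \<Prod>k\<in>{i, j}. Y k \<omega>)"
      by (rule indep_vars_integrable[OF _ ij]) (use that int in auto)
    moreover have "expectation (\<lambda>\<omega>. \<Prod>k\<in>{i, j}. Y k \<omega>) = (\<Prod>k\<in>{i, j}. expectation (Y k))"
      by (rule indep_vars_lebesgue_integral[OF _ ij]) (use that int in auto)
    ultimately show ?thesis using that zero by simp
  qed
  have ii: "integrable M (\<lambda>\<omega>. Y i \<omega> * Y j \<omega>)" if "i \<in> I" "j \<in> I" for i j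
    using off[OF that] int2[OF that(1)] by (cases "i = j") (auto simp: power2_eq_square)
  show "integrable M (\<lambda>\<omega>. (\<Sum>i\<in>I. Y i \<omega>)\<^sup>2)"
    unfolding sq using ii by auto
  have "expectation (\<lambda>\<omega>. (\<Sum>i\<in>I. Y i \<omega>)\<^sup>2) = (\<Sum>i\<in>I. \<Sum>j\<in>I. expectation (\<lambda>\<omega>. Y i \<omega> * Y j \<omega>))"
    unfolding sq using ii by (simp add: Bochner_Integration.integral_sum)
  also have "\<dots> = (\<Sum>i\<in>I. \<Sum>j\<in>I. if i = j then expectation (\<lambda>\<omega>. (Y i \<omega>)\<^sup>2) else 0)"
    using off by (intro sum.cong refl) (auto simp: power2_eq_square)
  also have "\<dots> = (\<Sum>i\<in>I. expectation (\<lambda>\<omega>. (Y i \<omega>)\<^sup>2))"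
    using I by simp
  finally show "expectation (\<lambda>\<omega>. (\<Sum>i\<in>I. Y i \<omega>)\<^sup>2) = (\<Sum>i\<in>I. expectation (\<lambda>\<omega>. (Y i \<omega>)\<^sup>2))" .
qed

locale wiener =
  fixes P :: "(real \<Rightarrow> real) measure"
  assumes wiener: "wiener_measure P"
begin

sublocale prob_space P
  using wiener by (simp add: wiener_measure_def)

lemma space_P: "space P = wiener_space"
proof -
  have "space P = space wiener_borel"
    using wiener by (intro sets_eq_imp_space_eq) (simp add: wiener_measure_def)
  also have "\<dots> = wiener_space"
    unfolding wiener_borel_def by (rule space_measure_of) (auto simp: openin_wiener_topology)
  finally show ?thesis .
qed

lemma increment_distributed:
  "0 \<le> s \<Longrightarrow> s < t \<Longrightarrow> distributed P lborel (\<lambda>w. w t - w s) (normal_density 0 (sqrt (t - s)))"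
  using wiener by (simp add: wiener_measure_def)

lemma increments_indep:
  assumes "0 \<le> t 0" "strict_mono_on {..n} t"
  shows "indep_vars (\<lambda>_. borel) (\<lambda>i w. w (t (Suc i)) - w (t i)) {..<n}"
  using wiener assms by (simp add: wiener_measure_def)

lemma measurable_eval[measurable]: "(\<lambda>w. w t) \<in> borel_measurable P"
proof (cases "t \<le> 0")
  case True
  then have "(\<lambda>w. w t) \<in> borel_measurable P \<longleftrightarrow> (\<lambda>w. 0 :: real) \<in> borel_measurable P"
    by (intro measurable_cong) (auto simp: space_P wiener_space_def less_eq_real_def)
  then show ?thesis by simp
next
  case False
  then have "(\<lambda>w. w t - w 0) \<in> borel_measurable P"
    using distributed_measurable[OF increment_distributed[of 0 t]] by simp
  also have "?this \<longleftrightarrow> ?thesis"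
    by (intro measurable_cong) (auto simp: space_P wiener_space_def)
  finally show ?thesis .
qed

lemma measurable_eval_family: "(\<lambda>w i. w (s i)) \<in> measurable P (borel :: ('i::countable \<Rightarrow> real) measure)"
  by (rule measurable_coordinatewise_then_product) simp

end

text \<open>Moving only coordinates with index at least \<open>n\<close> is moving along a line on which the derivative of \<open>f\<close> is
  zero. The partial derivatives inherit this, being determined by \<open>f\<close>.\<close>

lemma C1_bounded_local:
  assumes C: "C1_bounded n f f'" and eq: "\<And>i. i < n \<Longrightarrow> x i = y i"
  shows "f x = f y" and "i < n \<Longrightarrow> f' i x = f' i y"
proof -
  note D = C1_boundedD(5)[OF C]
  have loc: "f x = f y" if eq: "\<And>i. i < n \<Longrightarrow> x i = y i" for x y
  proof -
    have "((\<lambda>e. f (\<lambda>i. x i + e * (y i - x i))) has_real_derivative 0) (at e)" for e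
      using D[of x "\<lambda>i. y i - x i" e] eq by simp
    then have "f (\<lambda>i. x i + 0 * (y i - x i)) = f (\<lambda>i. x i + 1 * (y i - x i))"
      by (rule DERIV_isconst_all[rule_format])
    then show ?thesis by simp
  qed
  show "f x = f y" using loc eq by blast
  show "f' i x = f' i y" if "i < n"
  proof -
    let ?b = "\<lambda>j. if j = i then 1 else 0 :: real"
    have "(\<lambda>e. f (\<lambda>j. x j + e * ?b j)) = (\<lambda>e. f (\<lambda>j. y j + e * ?b j))"
      by (intro ext loc) (simp add: eq)
    then have "(\<Sum>j<n. ?b j * f' j (\<lambda>j. x j + 0 * ?b j)) = (\<Sum>j<n. ?b j * f' j (\<lambda>j. y j + 0 * ?b j))"
      using D[of x ?b 0] D[of y ?b 0] by (auto intro: DERIV_unique)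
    then show ?thesis using that by (simp add: sum.delta if_distrib[of "\<lambda>x. x * _"] cong: if_cong)
  qed
qed

text \<open>The times may come in arbitrary order and with repetitions. Brownian increments are independent
  along an increasing grid, and since the grid starts at \<open>0\<close>, every value of the path is a sum of
  such increments.\<close>

lemma finite_grid:
  fixes s :: "nat \<Rightarrow> real"
  assumes s: "\<And>i. i < n \<Longrightarrow> 0 \<le> s i"
  shows "\<exists>(N::nat) u \<kappa>. strict_mono_on {..N} u \<and> u 0 = 0 \<and> (\<forall>i<n. \<kappa> i \<le> N \<and> u (\<kappa> i) = s i)"
proof -
  define S where "S = insert 0 (s ` {..<n})"
  have S: "finite S" "0 \<in> S" "\<And>x. x \<in> S \<Longrightarrow> 0 \<le> x" using s by (auto simp: S_def)
  define us where "us = sorted_list_of_set S"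
  have us: "sorted_wrt (<) us" "set us = S" "length us = card S"
    using S(1) by (auto simp: us_def)
  have pos: "0 < card S" using S by (auto simp: card_gt_0_iff)
  have ex: "\<exists>k\<le>card S - 1. us ! k = x" if "x \<in> S" for x
  proof -
    have "x \<in> set us" using that us(2) by simp
    then obtain k where "k < length us" "us ! k = x" by (auto simp: in_set_conv_nth)
    then show ?thesis using us(3) by (intro exI[of _ k]) auto
  qed
  have mono: "strict_mono_on {..card S - 1} ((!) us)"
    using us(1,3) pos by (auto simp: strict_mono_on_def sorted_wrt_iff_nth_less)
  have "us ! 0 = 0"
  proof -
    obtain k where k: "k \<le> card S - 1" "us ! k = 0" using ex[OF S(2)] by blast
    have "us ! 0 \<in> set us" using us(3) pos by (intro nth_mem) simp
    then have "0 \<le> us ! 0" using S(3) us(2) by simp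
    moreover have "us ! 0 < us ! k" if "k > 0"
      using mono k(1) that by (auto simp: strict_mono_on_def)
    ultimately show ?thesis using k(2) by (cases "k = 0") auto
  qed
  moreover have "\<forall>i\<in>{..<n}. \<exists>k. k \<le> card S - 1 \<and> us ! k = s i"
    using ex by (auto simp: S_def)
  from bchoice[OF this] obtain \<kappa> where "\<And>i. i < n \<Longrightarrow> \<kappa> i \<le> card S - 1 \<and> us ! \<kappa> i = s i"
    by auto
  ultimately show ?thesis
    using mono by (intro exI[of _ "card S - 1"] exI[of _ "(!) us"] exI[of _ \<kappa>]) auto
qed

lemma sum_if_less:
  fixes F :: "nat \<Rightarrow> real"
  assumes "k \<le> N"
  shows "(\<Sum>j<N. if j < k then F j else 0) = (\<Sum>j<k. F j)"
proof -
  have "{..<N} \<inter> {j. j < k} = {..<k}" using assms by auto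
  then show ?thesis by (simp add: sum.If_cases)
qed

text \<open>The values of the path at the times \<open>s i\<close> are sums of the independent increments \<open>D k\<close> over a
  common grid, and \<open>h (s i)\<close> is the sum of the increments \<open>e k\<close> of \<open>h\<close> over the same cells.
  Integrating by parts in each \<open>D k\<close>, which has variance \<open>\<Delta> k\<close>, produces
  \<open>W = (\<Sum>k. e k / \<Delta> k * D k)\<close>. Its second moment \<open>\<Sum>k. (e k)\<^sup>2 / \<Delta> k\<close> is at most the energy of
  \<open>h\<close>, whatever the grid.\<close>

lemma (in wiener) cylinder_ibp:
  assumes C: "C1_bounded n f f'" and s: "\<And>i. i < n \<Longrightarrow> 0 \<le> s i" and h: "finite_energy h H K"
  obtains W where "W \<in> borel_measurable P" "integrable P (\<lambda>w. (W w)\<^sup>2)"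
    "expectation (\<lambda>w. (W w)\<^sup>2) \<le> K"
    "expectation (\<lambda>w. \<Sum>i<n. h (s i) * f' i (\<lambda>i. w (s i))) = expectation (\<lambda>w. f (\<lambda>i. w (s i)) * W w)"
proof -
  note C' = C1_boundedD[OF C] and h' = finite_energyD[OF h]
  obtain N :: nat and u :: "nat \<Rightarrow> real" and \<kappa> where mono: "strict_mono_on {..N} u" and u0: "u 0 = 0"
    and \<kappa>: "\<And>i. i < n \<Longrightarrow> \<kappa> i \<le> N" "\<And>i. i < n \<Longrightarrow> u (\<kappa> i) = s i"
    using finite_grid[of n s] s by blast
  have umono: "u j < u k" if "j < k" "k \<le> N" for j k
    using mono that by (auto simp: strict_mono_on_def)
  have unn: "0 \<le> u k" if "k \<le> N" for k
    using umono[of 0 k] that u0 by (cases "k = 0") auto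
  define D where "D j w = w (u (Suc j)) - w (u j)" for j and w :: "real \<Rightarrow> real"
  define \<Delta> where "\<Delta> j = u (Suc j) - u j" for j
  define e where "e j = h (u (Suc j)) - h (u j)" for j
  have \<Delta>: "\<Delta> j > 0" if "j < N" for j using umono[of j "Suc j"] that by (simp add: \<Delta>_def)
  have ind: "indep_vars (\<lambda>_. borel) D {..<N}"
    unfolding D_def[abs_def] by (rule increments_indep) (use u0 mono in auto)
  have Dd: "distributed P lborel (D j) (normal_density 0 (sqrt (\<Delta> j)))" if "j < N" for j
    unfolding D_def[abs_def] \<Delta>_def using that unn[of j] umono[of j "Suc j"] by (intro increment_distributed) auto
  have [measurable]: "D j \<in> borel_measurable P" for j
    unfolding D_def[abs_def] by measurable
  \<comment> \<open>The matrix of the linear map from increments to values: cell \<open>k\<close> contributes to time \<open>s i\<close> iff it lies to its left.\<close>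
  define b where "b k i = (if i < n \<and> k < \<kappa> i then 1 else 0 :: real)" for k i
  define A where "A x i = (\<Sum>j<N. x j * b j i)" for x :: "nat \<Rightarrow> real" and i
  define g where "g x = f (A x)" for x
  define g' where "g' k x = (\<Sum>i<n. b k i * f' i (A x))" for k x
  have contA: "continuous_on UNIV A"
    unfolding A_def[abs_def]
    by (intro continuous_on_coordinatewise_then_product continuous_intros continuous_on_product_coordinates)
  have tele: "F (u (\<kappa> i)) - F (u 0) = (\<Sum>j<N. (F (u (Suc j)) - F (u j)) * b j i)" if "i < n" for F :: "real \<Rightarrow> real" and i
  proof -
    have "(\<Sum>j<N. (F (u (Suc j)) - F (u j)) * b j i) = (\<Sum>j<N. if j < \<kappa> i then F (u (Suc j)) - F (u j) else 0)"
      using that by (intro sum.cong) (auto simp: b_def)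
    then show ?thesis
      using sum_lessThan_telescope[of "\<lambda>j. F (u j)" "\<kappa> i"] \<kappa>(1)[OF that] by (simp add: sum_if_less)
  qed
  have path: "A (\<lambda>j\<in>{..<N}. D j w) i = w (s i)" if "i < n" "w \<in> space P" for i w
    using tele[OF that(1), of w] that(2) \<kappa>(2)[OF that(1)] u0
    by (simp add: A_def D_def space_P wiener_space_def)
  have hs: "h (s i) = (\<Sum>j<N. e j * b j i)" if "i < n" for i
    using tele[OF that(1), of h] \<kappa>(2)[OF that] u0 h'(1)[of 0] by (simp add: e_def)
  have fw: "f (\<lambda>i. w (s i)) = g (\<lambda>j\<in>{..<N}. D j w)" if "w \<in> space P" for w
    unfolding g_def using path that by (intro C1_bounded_local(1)[OF C]) simp
  have f'w: "f' i (\<lambda>i. w (s i)) = f' i (A (\<lambda>j\<in>{..<N}. D j w))" if "w \<in> space P" "i < n" for w i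
    using path that by (intro C1_bounded_local(2)[OF C]) simp_all
  have coord: "expectation (\<lambda>w. g' k (\<lambda>j\<in>{..<N}. D j w)) = expectation (\<lambda>w. g (\<lambda>j\<in>{..<N}. D j w) * D k w) / \<Delta> k"
    if k: "k < N" for k
  proof -
    have "expectation (\<lambda>w. g' k (\<lambda>j\<in>{..<N}. D j w)) = expectation (\<lambda>w. g (\<lambda>j\<in>{..<N}. D j w) * D k w) / (sqrt (\<Delta> k))\<^sup>2"
    proof (rule gaussian_ibp_coordinate[OF _ _ ind Dd[OF k]])
      show "continuous_on UNIV g"
        unfolding g_def by (rule continuous_on_compose2[OF C'(1) contA]) auto
      show "continuous_on UNIV (g' k)"
        unfolding g'_def[abs_def] by (intro continuous_intros continuous_on_compose2[OF C'(3) contA]) auto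
      show "bounded (range g)"
        unfolding g_def by (rule bounded_subset[OF C'(2)]) auto
      have "bounded (range (\<lambda>x. f' i (A x)))" if "i < n" for i
        by (rule bounded_subset[OF C'(4)[OF that]]) auto
      then show "bounded (range (g' k))"
        unfolding g'_def[abs_def] by (intro bounded_range_sum bounded_range_mult) (auto simp: bounded_iff)
      show "((\<lambda>t. g (x(k := t))) has_real_derivative g' k (x(k := t))) (at t)" for x t
      proof -
        define a where "a = A (x(k := 0))"
        have line: "A (x(k := t)) = (\<lambda>i. a i + t * b k i)" for t
        proof
          fix i
          have "A (x(k := t)) i = (\<Sum>j<N. (x(k := 0)) j * b j i + (if j = k then t * b k i else 0))"
            unfolding A_def by (intro sum.cong) auto
          then show "A (x(k := t)) i = a i + t * b k i"
            using k by (simp add: sum.distrib a_def A_def)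
        qed
        show ?thesis
          using C'(5)[of a "b k" t] by (simp add: g_def g'_def line)
      qed
    qed (use k \<Delta> in auto)
    then show ?thesis using \<Delta>[OF k] by simp
  qed
  obtain B where B: "\<And>x. \<bar>f x\<bar> \<le> B" using C'(2) by (auto simp: bounded_iff)
  have mf[measurable]: "(\<lambda>w. f (\<lambda>i. w (s i))) \<in> borel_measurable P"
    by (rule measurable_compose[OF measurable_eval_family borel_measurable_continuous_onI[OF C'(1)]])
  have mf': "(\<lambda>w. f' i (\<lambda>i. w (s i))) \<in> borel_measurable P" if "i < n" for i
    by (rule measurable_compose[OF measurable_eval_family borel_measurable_continuous_onI[OF C'(3)[OF that]]])
  have intD: "integrable P (D k)" "integrable P (\<lambda>w. (D k w)\<^sup>2)" "expectation (D k) = 0"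
     "expectation (\<lambda>w. (D k w)\<^sup>2) = \<Delta> k" if "k < N" for k
    using normal_integrable_power(1)[OF Dd[OF that], of 1] normal_integrable_power(1)[OF Dd[OF that], of 2]
      normal_moments[OF Dd[OF that]] \<Delta>[OF that] by simp_all
  have intfD: "integrable P (\<lambda>w. f (\<lambda>i. w (s i)) * D k w)" if "k < N" for k
    using B by (intro Bochner_Integration.integrable_bound[OF integrable_mult_right[OF integrable_abs[OF intD(1)[OF that]], of B]])
      (auto intro!: always_eventually mult_mono simp: abs_mult order_trans[OF B abs_ge_self] order_trans[OF abs_ge_zero B])
  have intf': "integrable P (\<lambda>w. f' i (\<lambda>i. w (s i)))" if i: "i < n" for i
  proof -
    obtain B' where "\<And>x. \<bar>f' i x\<bar> \<le> B'" using C'(4)[OF i] by (auto simp: bounded_iff)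
    then show ?thesis using mf'[OF i] by (intro integrable_const_bound[of _ B']) auto
  qed
  define W where "W w = (\<Sum>k<N. e k / \<Delta> k * D k w)" for w
  let ?Y = "\<lambda>k w. e k / \<Delta> k * D k w"
  have indY: "indep_vars (\<lambda>_. borel) ?Y {..<N}"
    by (rule indep_vars_compose2[OF ind]) auto
  have Ysq: "(\<lambda>w. (?Y k w)\<^sup>2) = (\<lambda>w. (e k / \<Delta> k)\<^sup>2 * (D k w)\<^sup>2)" for k
    by (intro ext power_mult_distrib)
  have Y: "integrable P (?Y k)" "integrable P (\<lambda>w. (?Y k w)\<^sup>2)" "expectation (?Y k) = 0"
    if "k \<in> {..<N}" for k
  proof -
    show "integrable P (?Y k)" "expectation (?Y k) = 0" using intD[of k] that by simp_all
    show "integrable P (\<lambda>w. (?Y k w)\<^sup>2)"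
      unfolding Ysq using intD[of k] that by (intro integrable_mult_right) simp
  qed
  have Wsq: "integrable P (\<lambda>w. (W w)\<^sup>2)"
    "expectation (\<lambda>w. (W w)\<^sup>2) = (\<Sum>k<N. expectation (\<lambda>w. (?Y k w)\<^sup>2))"
    unfolding W_def using indep_vars_sum_square[OF _ indY Y] by simp_all
  have "(\<Sum>k<N. expectation (\<lambda>w. (?Y k w)\<^sup>2)) \<le> (\<Sum>k<N. H (u (Suc k)) - H (u k))"
  proof (rule sum_mono)
    fix k assume "k \<in> {..<N}"
    then have k: "k < N" by simp
    have "expectation (\<lambda>w. (?Y k w)\<^sup>2) = (e k)\<^sup>2 / \<Delta> k"
      unfolding Ysq using intD[OF k] \<Delta>[OF k] by (simp add: power_divide power2_eq_square)
    also have "\<dots> \<le> H (u (Suc k)) - H (u k)"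
      using h'(4)[of "u k" "u (Suc k)"] unn[of k] umono[of k "Suc k"] k \<Delta>[OF k]
      by (simp add: e_def \<Delta>_def divide_le_eq mult.commute)
    finally show "expectation (\<lambda>w. (?Y k w)\<^sup>2) \<le> H (u (Suc k)) - H (u k)" .
  qed
  also have "\<dots> = H (u N) - H (u 0)" by (rule sum_lessThan_telescope)
  also have "\<dots> \<le> K" using h'(2)[of "u 0"] h'(3)[of "u N"] unn[of N] u0 by simp
  finally have K: "expectation (\<lambda>w. (W w)\<^sup>2) \<le> K" using Wsq(2) by simp
  have "expectation (\<lambda>w. \<Sum>i<n. h (s i) * f' i (\<lambda>i. w (s i)))
      = expectation (\<lambda>w. \<Sum>k<N. e k * g' k (\<lambda>j\<in>{..<N}. D j w))"
  proof (rule Bochner_Integration.integral_cong[OF refl])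
    fix w assume w: "w \<in> space P"
    have "(\<Sum>i<n. h (s i) * f' i (\<lambda>i. w (s i))) = (\<Sum>i<n. (\<Sum>k<N. e k * b k i) * f' i (A (\<lambda>j\<in>{..<N}. D j w)))"
      using w by (intro sum.cong) (simp_all add: hs f'w)
    also have "\<dots> = (\<Sum>k<N. e k * g' k (\<lambda>j\<in>{..<N}. D j w))"
      unfolding g'_def sum_distrib_right sum_distrib_left by (subst sum.swap) (simp add: mult_ac)
    finally show "(\<Sum>i<n. h (s i) * f' i (\<lambda>i. w (s i))) = (\<Sum>k<N. e k * g' k (\<lambda>j\<in>{..<N}. D j w))" .
  qed
  also have "\<dots> = (\<Sum>k<N. e k * expectation (\<lambda>w. g' k (\<lambda>j\<in>{..<N}. D j w)))"
  proof (subst Bochner_Integration.integral_sum)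
    fix k assume "k \<in> {..<N}"
    have "integrable P (\<lambda>w. \<Sum>i<n. b k i * f' i (\<lambda>i. w (s i)))"
      using intf' by auto
    also have "?this \<longleftrightarrow> integrable P (\<lambda>w. g' k (\<lambda>j\<in>{..<N}. D j w))"
      by (intro Bochner_Integration.integrable_cong refl) (simp add: g'_def f'w)
    finally show "integrable P (\<lambda>w. e k * g' k (\<lambda>j\<in>{..<N}. D j w))" by simp
  qed simp
  also have "\<dots> = (\<Sum>k<N. e k * (expectation (\<lambda>w. f (\<lambda>i. w (s i)) * D k w) / \<Delta> k))"
    using coord by (intro sum.cong) (auto simp: fw cong: Bochner_Integration.integral_cong)
  also have "\<dots> = (\<Sum>k<N. expectation (\<lambda>w. e k / \<Delta> k * (f (\<lambda>i. w (s i)) * D k w)))"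
    by simp
  also have "\<dots> = expectation (\<lambda>w. \<Sum>k<N. e k / \<Delta> k * (f (\<lambda>i. w (s i)) * D k w))"
    using intfD by (intro Bochner_Integration.integral_sum[symmetric]) auto
  also have "\<dots> = expectation (\<lambda>w. f (\<lambda>i. w (s i)) * W w)"
    by (intro Bochner_Integration.integral_cong refl) (simp add: W_def sum_distrib_left mult_ac)
  finally have "expectation (\<lambda>w. \<Sum>i<n. h (s i) * f' i (\<lambda>i. w (s i))) = expectation (\<lambda>w. f (\<lambda>i. w (s i)) * W w)" .
  moreover have "W \<in> borel_measurable P" unfolding W_def[abs_def] by measurable
  ultimately show thesis using Wsq(1) K by (intro that) auto
qed

section \<open>Closability for a fixed time\<close>

text \<open>For nonnegative terms the sum and the integral can be exchanged, so the functions are summable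
  almost everywhere as well as in \<open>L\<^sup>1\<close>.\<close>

lemma summable_L1_norms:
  fixes g :: "nat \<Rightarrow> 'a \<Rightarrow> real"
  assumes [measurable]: "\<And>n. g n \<in> borel_measurable M"
    and fin: "(\<Sum>n. \<integral>\<^sup>+ x. ennreal \<bar>g n x\<bar> \<partial>M) < \<infinity>"
  shows "integrable M (g n)"
    and "(\<lambda>n. \<integral>x. \<bar>g n x\<bar> \<partial>M) \<longlonglongrightarrow> 0"
    and "AE x in M. (\<lambda>n. g n x) \<longlonglongrightarrow> 0"
proof -
  have le: "(\<integral>\<^sup>+ x. ennreal \<bar>g n x\<bar> \<partial>M) < \<infinity>" for n
    using sum_le_suminf[of "\<lambda>n. \<integral>\<^sup>+ x. ennreal \<bar>g n x\<bar> \<partial>M" "{n}"] fin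
    by (auto simp: summableI intro: le_less_trans)
  then show int: "integrable M (g n)" for n
    by (intro integrableI_bounded) (auto simp: real_norm_def)
  have "(\<integral>\<^sup>+ x. ennreal \<bar>g n x\<bar> \<partial>M) = ennreal (\<integral>x. \<bar>g n x\<bar> \<partial>M)" for n
    using int by (intro nn_integral_eq_integral) auto
  then have "summable (\<lambda>n. \<integral>x. \<bar>g n x\<bar> \<partial>M)"
    using fin by (intro summable_suminf_not_top) (auto simp: less_top)
  then show "(\<lambda>n. \<integral>x. \<bar>g n x\<bar> \<partial>M) \<longlonglongrightarrow> 0" by (rule summable_LIMSEQ_zero)
  have "(\<integral>\<^sup>+ x. (\<Sum>n. ennreal \<bar>g n x\<bar>) \<partial>M) < \<infinity>"
    using fin by (subst nn_integral_suminf) auto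
  then have "AE x in M. (\<Sum>n. ennreal \<bar>g n x\<bar>) \<noteq> \<infinity>"
    by (intro nn_integral_PInf_AE) (auto simp: less_top)
  then show "AE x in M. (\<lambda>n. g n x) \<longlonglongrightarrow> 0"
  proof eventually_elim
    case (elim x)
    then have "summable (\<lambda>n. \<bar>g n x\<bar>)"
      by (intro summable_suminf_not_top) auto
    then show ?case
      using summable_LIMSEQ_zero tendsto_rabs_zero_iff by blast
  qed
qed

lemma Cauchy_Schwarz_integral:
  fixes X Y :: "'a \<Rightarrow> real"
  assumes [measurable]: "X \<in> borel_measurable M" "Y \<in> borel_measurable M"
    and X: "integrable M (\<lambda>x. (X x)\<^sup>2)" and Y: "integrable M (\<lambda>x. (Y x)\<^sup>2)"
  shows "\<bar>\<integral>x. X x * Y x \<partial>M\<bar> \<le> sqrt (\<integral>x. (X x)\<^sup>2 \<partial>M) * sqrt (\<integral>x. (Y x)\<^sup>2 \<partial>M)" "integrable M (\<lambda>x. X x * Y x)"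
proof -
  have sq: "(ennreal \<bar>x\<bar>)\<^sup>2 = ennreal (x\<^sup>2)" for x :: real
    by (simp add: ennreal_power)
  show int: "integrable M (\<lambda>x. X x * Y x)"
  proof (rule Bochner_Integration.integrable_bound[OF Bochner_Integration.integrable_add[OF X Y]])
    show "AE x in M. norm (X x * Y x) \<le> norm ((X x)\<^sup>2 + (Y x)\<^sup>2)"
    proof (rule AE_I2)
      fix x
      have "0 \<le> (\<bar>X x\<bar> - \<bar>Y x\<bar>)\<^sup>2" by simp
      then have "2 * (\<bar>X x\<bar> * \<bar>Y x\<bar>) \<le> (X x)\<^sup>2 + (Y x)\<^sup>2" by (simp add: power2_diff)
      moreover have "0 \<le> \<bar>X x\<bar> * \<bar>Y x\<bar>" by simp
      ultimately have "\<bar>X x\<bar> * \<bar>Y x\<bar> \<le> (X x)\<^sup>2 + (Y x)\<^sup>2" by linarith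
      then show "norm (X x * Y x) \<le> norm ((X x)\<^sup>2 + (Y x)\<^sup>2)"
        by (simp add: abs_mult)
    qed
  qed simp
  have "(\<integral>\<^sup>+ x. ennreal \<bar>X x\<bar> * ennreal \<bar>Y x\<bar> \<partial>M)\<^sup>2 \<le> (\<integral>\<^sup>+ x. (ennreal \<bar>X x\<bar>)\<^sup>2 \<partial>M) * (\<integral>\<^sup>+ x. (ennreal \<bar>Y x\<bar>)\<^sup>2 \<partial>M)"
    by (rule Cauchy_Schwarz_nn_integral) auto
  also have "(\<integral>\<^sup>+ x. ennreal \<bar>X x\<bar> * ennreal \<bar>Y x\<bar> \<partial>M) = ennreal (\<integral>x. \<bar>X x * Y x\<bar> \<partial>M)"
    using int by (simp add: ennreal_mult[symmetric] abs_mult[symmetric] nn_integral_eq_integral)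
  also have "(\<integral>\<^sup>+ x. (ennreal \<bar>X x\<bar>)\<^sup>2 \<partial>M) = ennreal (\<integral>x. (X x)\<^sup>2 \<partial>M)"
    unfolding sq using X by (intro nn_integral_eq_integral) auto
  also have "(\<integral>\<^sup>+ x. (ennreal \<bar>Y x\<bar>)\<^sup>2 \<partial>M) = ennreal (\<integral>x. (Y x)\<^sup>2 \<partial>M)"
    unfolding sq using Y by (intro nn_integral_eq_integral) auto
  finally have "(\<integral>x. \<bar>X x * Y x\<bar> \<partial>M)\<^sup>2 \<le> (\<integral>x. (X x)\<^sup>2 \<partial>M) * (\<integral>x. (Y x)\<^sup>2 \<partial>M)"
    by (simp add: ennreal_power ennreal_mult[symmetric] ennreal_le_iff)
  then have "sqrt ((\<integral>x. \<bar>X x * Y x\<bar> \<partial>M)\<^sup>2) \<le> sqrt ((\<integral>x. (X x)\<^sup>2 \<partial>M) * (\<integral>x. (Y x)\<^sup>2 \<partial>M))"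
    by (rule real_sqrt_le_mono)
  then have "(\<integral>x. \<bar>X x * Y x\<bar> \<partial>M) \<le> sqrt (\<integral>x. (X x)\<^sup>2 \<partial>M) * sqrt (\<integral>x. (Y x)\<^sup>2 \<partial>M)"
    by (simp add: real_sqrt_mult)
  then show "\<bar>\<integral>x. X x * Y x \<partial>M\<bar> \<le> sqrt (\<integral>x. (X x)\<^sup>2 \<partial>M) * sqrt (\<integral>x. (Y x)\<^sup>2 \<partial>M)"
    using integral_abs_bound[of M "\<lambda>x. X x * Y x"] by linarith
qed

lemma abs_arctan_le_abs: "\<bar>arctan x\<bar> \<le> \<bar>x\<bar>" for x :: real
  using arctan_le_self[of x] arctan_le_self[of "- x"] by (cases "0 \<le> x") (auto simp: arctan_minus)

context wiener
begin

lemma C1_bounded_eval: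
  assumes "C1_bounded n f f'"
  shows "(\<lambda>w. f (\<lambda>i. w (s i))) \<in> borel_measurable P"
    "i < n \<Longrightarrow> (\<lambda>w. f' i (\<lambda>i. w (s i))) \<in> borel_measurable P"
  by (auto intro!: measurable_compose[OF measurable_eval_family borel_measurable_continuous_onI] C1_boundedD[OF assms])

lemma cylinder_ibp_product:
  assumes f: "C1_bounded n f f'" and s: "\<And>i. i < n \<Longrightarrow> 0 \<le> s i"
    and g: "C1_bounded m g g'" and r: "\<And>i. i < m \<Longrightarrow> 0 \<le> r i"
    and h: "finite_energy h H K"
  obtains W where "W \<in> borel_measurable P" "integrable P (\<lambda>w. (W w)\<^sup>2)"
    "expectation (\<lambda>w. (W w)\<^sup>2) \<le> K"
    "expectation (\<lambda>w. (\<Sum>i<n. h (s i) * f' i (\<lambda>i. w (s i))) * g (\<lambda>i. w (r i))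
        + f (\<lambda>i. w (s i)) * (\<Sum>i<m. h (r i) * g' i (\<lambda>i. w (r i))))
      = expectation (\<lambda>w. f (\<lambda>i. w (s i)) * g (\<lambda>i. w (r i)) * W w)"
proof -
  define t where "t i = (if i < n then s i else r (i - n))" for i
  have t: "0 \<le> t i" if "i < n + m" for i using that s r by (auto simp: t_def)
  have tn: "t (n + i) = r i" for i by (simp add: t_def)
  have ft: "f (\<lambda>i. w (t i)) = f (\<lambda>i. w (s i))" for w
    by (rule C1_bounded_local(1)[OF f]) (simp add: t_def)
  have f't: "f' i (\<lambda>i. w (t i)) = f' i (\<lambda>i. w (s i))" if "i < n" for w i
    by (rule C1_bounded_local(2)[OF f]) (use that in \<open>simp_all add: t_def\<close>)
  show thesis
  proof (rule cylinder_ibp[OF C1_bounded_mult[OF f g] t h])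
    fix W
    assume W: "W \<in> borel_measurable P" "integrable P (\<lambda>w. (W w)\<^sup>2)" "expectation (\<lambda>w. (W w)\<^sup>2) \<le> K"
      and eq: "expectation (\<lambda>w. \<Sum>i<n + m. h (t i) * (if i < n then f' i (\<lambda>i. w (t i)) * g (\<lambda>i. w (t (n + i)))
           else f (\<lambda>i. w (t i)) * g' (i - n) (\<lambda>i. w (t (n + i))))) =
         expectation (\<lambda>w. f (\<lambda>i. w (t i)) * g (\<lambda>i. w (t (n + i))) * W w)"
    have "(\<Sum>i<n + m. h (t i) * (if i < n then f' i (\<lambda>i. w (t i)) * g (\<lambda>i. w (t (n + i)))
           else f (\<lambda>i. w (t i)) * g' (i - n) (\<lambda>i. w (t (n + i))))) =
       (\<Sum>i<n. h (s i) * f' i (\<lambda>i. w (s i))) * g (\<lambda>i. w (r i))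
        + f (\<lambda>i. w (s i)) * (\<Sum>i<m. h (r i) * g' i (\<lambda>i. w (r i)))" for w
      unfolding sum_lessThan_add_split
      by (simp add: tn ft f't sum_distrib_left sum_distrib_right mult_ac) (simp add: t_def mult_ac)
    with eq have "expectation (\<lambda>w. (\<Sum>i<n. h (s i) * f' i (\<lambda>i. w (s i))) * g (\<lambda>i. w (r i))
        + f (\<lambda>i. w (s i)) * (\<Sum>i<m. h (r i) * g' i (\<lambda>i. w (r i))))
      = expectation (\<lambda>w. f (\<lambda>i. w (s i)) * g (\<lambda>i. w (r i)) * W w)"
      by (simp add: tn ft)
    with W show thesis by (rule that)
  qed
qed

text \<open>Integration by parts is applied to \<open>arctan (F n) * arctan (DF k)\<close>. For \<open>n \<rightarrow> \<infinity>\<close> the terms that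
  contain \<open>arctan (F n)\<close> undifferentiated vanish, the one with \<open>W\<close> by the Cauchy--Schwarz
  inequality and the uniform bound \<open>K\<close>, and there remains \<open>E[Z * arctan (DF k)] = 0\<close>. For
  \<open>k \<rightarrow> \<infinity>\<close> this becomes \<open>E[Z * arctan Z] = 0\<close>.\<close>

lemma closable_along_fast_sequence:
  fixes f :: "nat \<Rightarrow> (nat \<Rightarrow> real) \<Rightarrow> real" and Z :: "(real \<Rightarrow> real) \<Rightarrow> real"
  assumes h: "finite_energy h H K"
    and f: "\<And>n. C1_bounded (N n) (f n) (f' n)"
    and f': "\<And>n i. i < N n \<Longrightarrow> C1_bounded (N n) (f' n i) (f'' n i)"
    and s: "\<And>n i. i < N n \<Longrightarrow> 0 \<le> s n i"
    and F: "\<And>n w. F n w = f n (\<lambda>i. w (s n i))"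
    and DF: "\<And>n w. DF n w = (\<Sum>i<N n. h (s n i) * f' n i (\<lambda>i. w (s n i)))"
    and Z[measurable]: "Z \<in> borel_measurable P"
    and sumF: "(\<Sum>n. \<integral>\<^sup>+ w. ennreal \<bar>F n w\<bar> \<partial>P) < \<infinity>"
    and sumDF: "(\<Sum>n. \<integral>\<^sup>+ w. ennreal \<bar>DF n w - Z w\<bar> \<partial>P) < \<infinity>"
  shows "AE w in P. Z w = 0"
proof -
  have [measurable]: "F n \<in> borel_measurable P" for n
    unfolding F[abs_def] by (rule C1_bounded_eval[OF f])
  have mDF[measurable]: "DF n \<in> borel_measurable P" for n
    unfolding DF[abs_def] using C1_bounded_eval(2)[OF f] by (intro borel_measurable_sum borel_measurable_times) auto
  note F1 = summable_L1_norms[of F P, OF _ sumF, simplified]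
  note D1 = summable_L1_norms[of "\<lambda>n w. DF n w - Z w" P, OF _ sumDF, simplified]
  have intDF: "integrable P (DF n)" for n
  proof -
    have "bounded (range (\<lambda>x. \<Sum>i<N n. h (s n i) * f' n i x))"
      using C1_boundedD(4)[OF f] by (intro bounded_range_sum bounded_range_mult) (auto simp: bounded_iff)
    then obtain C where "\<And>x. \<bar>\<Sum>i<N n. h (s n i) * f' n i x\<bar> \<le> C"
      by (auto simp: bounded_iff)
    then have "\<bar>DF n w\<bar> \<le> C" for w unfolding DF by blast
    then show ?thesis by (intro integrable_const_bound[of _ C]) auto
  qed
  have intZ: "integrable P Z"
    using Bochner_Integration.integrable_diff[OF intDF[of 0] D1(1)[of 0]] by simp
  have zero: "expectation (\<lambda>w. Z w * arctan (DF k w)) = 0" for k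
  proof -
    define a where "a w = arctan (DF k w)" for w
    have [measurable]: "a \<in> borel_measurable P" unfolding a_def[abs_def] by measurable
    have a: "\<bar>a w\<bar> \<le> pi / 2" for w unfolding a_def by (rule abs_arctan_le)
    have ya: "\<bar>y * a w\<bar> \<le> \<bar>y\<bar> * (pi / 2)" for y w
      unfolding abs_mult by (intro mult_left_mono a) simp
    define G where "G x = (\<Sum>j<N k. h (s k j) * f' k j x)" for x
    define G' where "G' i x = (\<Sum>j<N k. h (s k j) * f'' k j i x)" for i x
    have G: "C1_bounded (N k) G G'"
      unfolding G_def[abs_def] G'_def[abs_def] by (rule C1_bounded_lincomb) (rule f')
    note aG = C1_bounded_arctan[OF G]
    have aw: "arctan (G (\<lambda>i. w (s k i))) = a w" for w
      by (simp add: a_def G_def DF)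
    define E where "E w = (\<Sum>i<N k. h (s k i) * (G' i (\<lambda>i. w (s k i)) / (1 + (G (\<lambda>i. w (s k i)))\<^sup>2)))" for w
    have [measurable]: "E \<in> borel_measurable P"
      unfolding E_def[abs_def] using C1_bounded_eval(2)[OF aG] by (intro borel_measurable_sum borel_measurable_times) auto
    have "bounded (range (\<lambda>x. \<Sum>i<N k. h (s k i) * (G' i x / (1 + (G x)\<^sup>2))))"
      using C1_boundedD(4)[OF aG] by (intro bounded_range_sum bounded_range_mult) (auto simp: bounded_iff)
    then obtain C where "\<And>x. \<bar>\<Sum>i<N k. h (s k i) * (G' i x / (1 + (G x)\<^sup>2))\<bar> \<le> C"
      by (auto simp: bounded_iff)
    then have C: "\<bar>E w\<bar> \<le> C" for w unfolding E_def by blast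
    have C0: "0 \<le> C" using C[of undefined] by linarith
    \<comment> \<open>\<open>p n\<close> is the derivative of \<open>arctan (F n)\<close> along \<open>h\<close>, and \<open>E\<close> that of \<open>arctan (DF k)\<close>.\<close>
    define p where "p n w = DF n w / (1 + (F n w)\<^sup>2)" for n w
    have [measurable]: "p n \<in> borel_measurable P" for n unfolding p_def[abs_def] by measurable
    have q: "0 \<le> 1 / (1 + y\<^sup>2)" "1 / (1 + y\<^sup>2) \<le> 1" for y :: real
      by (auto simp: divide_le_eq_1 add_pos_nonneg)
    have pint: "integrable P (\<lambda>w. p n w * a w)" for n
    proof (rule Bochner_Integration.integrable_bound[OF integrable_mult_right[OF intDF[of n], of "pi / 2"]])
      show "AE w in P. norm (p n w * a w) \<le> norm (pi / 2 * DF n w)"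
      proof (rule AE_I2)
        fix w
        have "\<bar>p n w\<bar> \<le> \<bar>DF n w\<bar>"
          using q[of "F n w"] mult_left_mono[OF q(2)[of "F n w"], of "\<bar>DF n w\<bar>"] by (simp add: p_def abs_mult)
        then show "norm (p n w * a w) \<le> norm (pi / 2 * DF n w)"
          using mult_mono[OF _ a, of "\<bar>p n w\<bar>" "\<bar>DF n w\<bar>" w] by (simp add: abs_mult mult.commute)
      qed
    qed simp
    have aint: "integrable P (\<lambda>w. arctan (F n w) * E w)" for n
    proof (rule integrable_const_bound)
      show "AE w in P. norm (arctan (F n w) * E w) \<le> pi / 2 * C"
        unfolding real_norm_def abs_mult by (intro AE_I2 mult_mono C abs_arctan_le) auto
    qed simp
    have bound: "\<bar>expectation (\<lambda>w. p n w * a w)\<bar> \<le>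
       sqrt (pi / 2 * (pi / 2) * (pi / 2) * expectation (\<lambda>w. \<bar>F n w\<bar>)) * sqrt K + C * expectation (\<lambda>w. \<bar>F n w\<bar>)" for n
    proof (rule cylinder_ibp_product[OF C1_bounded_arctan[OF f[of n]] s aG s h])
      fix W
      assume W[measurable]: "W \<in> borel_measurable P" and W2: "integrable P (\<lambda>w. (W w)\<^sup>2)" "expectation (\<lambda>w. (W w)\<^sup>2) \<le> K"
       and eq: "expectation (\<lambda>w. (\<Sum>i<N n. h (s n i) * (f' n i (\<lambda>i. w (s n i)) / (1 + (f n (\<lambda>i. w (s n i)))\<^sup>2))) *
             arctan (G (\<lambda>i. w (s k i))) + arctan (f n (\<lambda>i. w (s n i))) *
             (\<Sum>i<N k. h (s k i) * (G' i (\<lambda>i. w (s k i)) / (1 + (G (\<lambda>i. w (s k i)))\<^sup>2)))) =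
          expectation (\<lambda>w. arctan (f n (\<lambda>i. w (s n i))) * arctan (G (\<lambda>i. w (s k i))) * W w)"
      have pw: "(\<Sum>i<N n. h (s n i) * (f' n i (\<lambda>i. w (s n i)) / (1 + (f n (\<lambda>i. w (s n i)))\<^sup>2))) = p n w" for w
        by (simp add: p_def DF F sum_divide_distrib)
      have eq: "expectation (\<lambda>w. p n w * a w + arctan (F n w) * E w) = expectation (\<lambda>w. arctan (F n w) * a w * W w)"
        using eq unfolding E_def by (simp only: pw aw F)
      let ?X = "\<lambda>w. arctan (F n w) * a w"
      \<comment> \<open>One of the two factors \<open>arctan (F n w)\<close> is bounded by \<open>pi / 2\<close> and the other by \<open>\<bar>F n w\<bar>\<close>: this trades the second moment for the \<open>L\<^sup>1\<close> norm.\<close>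
      have Xsq: "(?X w)\<^sup>2 \<le> pi / 2 * (pi / 2) * (pi / 2) * \<bar>F n w\<bar>" for w
      proof -
        have "(?X w)\<^sup>2 = \<bar>a w\<bar> * \<bar>a w\<bar> * (\<bar>arctan (F n w)\<bar> * \<bar>arctan (F n w)\<bar>)"
          by (simp add: power2_eq_square abs_mult_self_eq)
        also have "\<dots> \<le> (pi / 2 * (pi / 2)) * (pi / 2 * \<bar>F n w\<bar>)"
          by (intro mult_mono a abs_arctan_le abs_arctan_le_abs) auto
        finally show ?thesis by (simp add: mult_ac)
      qed
      have X2: "integrable P (\<lambda>w. (?X w)\<^sup>2)"
        by (rule Bochner_Integration.integrable_bound[OF integrable_mult_right[OF integrable_abs[OF F1(1)[of n]], of "pi / 2 * (pi / 2) * (pi / 2)"]])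
          (use Xsq in \<open>auto intro!: AE_I2 order_trans[OF _ abs_ge_self]\<close>)
      have "\<bar>expectation (\<lambda>w. ?X w * W w)\<bar> \<le> sqrt (expectation (\<lambda>w. (?X w)\<^sup>2)) * sqrt (expectation (\<lambda>w. (W w)\<^sup>2))"
        by (rule Cauchy_Schwarz_integral) (use X2 W2 in auto)
      also have "\<dots> \<le> sqrt (expectation (\<lambda>w. pi / 2 * (pi / 2) * (pi / 2) * \<bar>F n w\<bar>)) * sqrt K"
        using W2 by (intro mult_mono real_sqrt_le_mono integral_mono X2 Xsq integrable_mult_right integrable_abs F1(1)) auto
      finally have A: "\<bar>expectation (\<lambda>w. ?X w * W w)\<bar> \<le> sqrt (pi / 2 * (pi / 2) * (pi / 2) * expectation (\<lambda>w. \<bar>F n w\<bar>)) * sqrt K"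
        by (simp only: integral_mult_right_zero)
      have "\<bar>expectation (\<lambda>w. arctan (F n w) * E w)\<bar> \<le> expectation (\<lambda>w. \<bar>arctan (F n w) * E w\<bar>)"
        by (rule integral_abs_bound)
      also have "\<dots> \<le> expectation (\<lambda>w. C * \<bar>F n w\<bar>)"
      proof (rule integral_mono)
        show "\<bar>arctan (F n w) * E w\<bar> \<le> C * \<bar>F n w\<bar>" for w
          using mult_mono[OF abs_arctan_le_abs C, of "F n w" w] by (simp add: abs_mult mult.commute)
      qed (use aint F1(1) in auto)
      finally have B: "\<bar>expectation (\<lambda>w. arctan (F n w) * E w)\<bar> \<le> C * expectation (\<lambda>w. \<bar>F n w\<bar>)" by simp
      have "expectation (\<lambda>w. p n w * a w) = expectation (\<lambda>w. ?X w * W w) - expectation (\<lambda>w. arctan (F n w) * E w)"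
        using eq pint aint by simp
      then show ?thesis using A B by linarith
    qed
    have "(\<lambda>n. sqrt (pi / 2 * (pi / 2) * (pi / 2) * expectation (\<lambda>w. \<bar>F n w\<bar>)) * sqrt K + C * expectation (\<lambda>w. \<bar>F n w\<bar>))
       \<longlonglongrightarrow> sqrt (pi / 2 * (pi / 2) * (pi / 2) * 0) * sqrt K + C * 0"
      by (intro tendsto_intros F1(2))
    then have "(\<lambda>n. sqrt (pi / 2 * (pi / 2) * (pi / 2) * expectation (\<lambda>w. \<bar>F n w\<bar>)) * sqrt K + C * expectation (\<lambda>w. \<bar>F n w\<bar>))
       \<longlonglongrightarrow> 0" by simp
    then have lim0: "(\<lambda>n. expectation (\<lambda>w. p n w * a w)) \<longlonglongrightarrow> 0"
      by (rule tendsto_0_le[where K = 1]) (use bound in \<open>auto intro!: always_eventually order_trans[OF _ abs_ge_self]\<close>)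
    have Zint: "integrable P (\<lambda>w. Z w * a w / (1 + (F n w)\<^sup>2))" for n
    proof (rule Bochner_Integration.integrable_bound[OF integrable_mult_right[OF intZ, of "pi / 2"]])
      show "AE w in P. norm (Z w * a w / (1 + (F n w)\<^sup>2)) \<le> norm (pi / 2 * Z w)"
      proof (rule AE_I2)
        fix w
        have "\<bar>Z w * a w\<bar> * (1 / (1 + (F n w)\<^sup>2)) \<le> (\<bar>Z w\<bar> * (pi / 2)) * 1"
          by (intro mult_mono q ya) auto
        then show "norm (Z w * a w / (1 + (F n w)\<^sup>2)) \<le> norm (pi / 2 * Z w)"
          by (simp add: abs_mult mult.commute)
      qed
    qed simp
    have "(\<lambda>n. expectation (\<lambda>w. Z w * a w / (1 + (F n w)\<^sup>2))) \<longlonglongrightarrow> expectation (\<lambda>w. Z w * a w)"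
    proof (rule integral_dominated_convergence)
      show "integrable P (\<lambda>w. \<bar>Z w\<bar> * (pi / 2))" using intZ by simp
      show "AE w in P. (\<lambda>n. Z w * a w / (1 + (F n w)\<^sup>2)) \<longlonglongrightarrow> Z w * a w"
        using F1(3)
      proof eventually_elim
        case (elim w)
        then have "(\<lambda>n. Z w * a w / (1 + (F n w)\<^sup>2)) \<longlonglongrightarrow> Z w * a w / (1 + 0\<^sup>2)"
          by (intro tendsto_intros) auto
        then show ?case by simp
      qed
      show "AE w in P. norm (Z w * a w / (1 + (F n w)\<^sup>2)) \<le> \<bar>Z w\<bar> * (pi / 2)" for n
      proof (rule AE_I2)
        fix w
        have "\<bar>Z w * a w\<bar> * (1 / (1 + (F n w)\<^sup>2)) \<le> (\<bar>Z w\<bar> * (pi / 2)) * 1"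
          by (intro mult_mono q ya) auto
        then show "norm (Z w * a w / (1 + (F n w)\<^sup>2)) \<le> \<bar>Z w\<bar> * (pi / 2)"
          by (simp add: abs_mult mult.commute)
      qed
    qed auto
    moreover have "(\<lambda>n. expectation (\<lambda>w. p n w * a w) - expectation (\<lambda>w. Z w * a w / (1 + (F n w)\<^sup>2))) \<longlonglongrightarrow> 0"
    proof (rule tendsto_0_le[OF D1(2), of _ "pi / 2"], rule always_eventually, rule allI)
      fix n
      have eq: "expectation (\<lambda>w. p n w * a w) - expectation (\<lambda>w. Z w * a w / (1 + (F n w)\<^sup>2))
         = expectation (\<lambda>w. p n w * a w - Z w * a w / (1 + (F n w)\<^sup>2))"
        using pint Zint by simp
      have "\<bar>expectation (\<lambda>w. p n w * a w) - expectation (\<lambda>w. Z w * a w / (1 + (F n w)\<^sup>2))\<bar>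
          \<le> expectation (\<lambda>w. \<bar>p n w * a w - Z w * a w / (1 + (F n w)\<^sup>2)\<bar>)"
        unfolding eq by (rule integral_abs_bound)
      also have "\<dots> \<le> expectation (\<lambda>w. \<bar>DF n w - Z w\<bar> * (pi / 2))"
      proof (rule integral_mono)
        fix w
        have "p n w * a w - Z w * a w / (1 + (F n w)\<^sup>2) = (DF n w - Z w) * a w * (1 / (1 + (F n w)\<^sup>2))"
          by (simp add: p_def diff_divide_distrib algebra_simps)
        moreover have "\<bar>(DF n w - Z w) * a w\<bar> * (1 / (1 + (F n w)\<^sup>2)) \<le> (\<bar>DF n w - Z w\<bar> * (pi / 2)) * 1"
          by (intro mult_mono q ya) auto
        ultimately show "\<bar>p n w * a w - Z w * a w / (1 + (F n w)\<^sup>2)\<bar> \<le> \<bar>DF n w - Z w\<bar> * (pi / 2)"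
          using q(1)[of "F n w"] by (simp add: abs_mult)
      qed (use pint Zint D1(1) in auto)
      also have "\<dots> = norm (expectation (\<lambda>w. \<bar>DF n w - Z w\<bar>)) * (pi / 2)"
        by simp
      finally show "norm (expectation (\<lambda>w. p n w * a w) - expectation (\<lambda>w. Z w * a w / (1 + (F n w)\<^sup>2)))
         \<le> norm (expectation (\<lambda>w. \<bar>DF n w - Z w\<bar>)) * (pi / 2)" by simp
    qed
    ultimately have "(\<lambda>n. expectation (\<lambda>w. p n w * a w)) \<longlonglongrightarrow> expectation (\<lambda>w. Z w * a w)"
      by (rule Lim_transform)
    from LIMSEQ_unique[OF this lim0] show ?thesis
      unfolding a_def .
  qed
  have "(\<lambda>k. expectation (\<lambda>w. Z w * arctan (DF k w))) \<longlonglongrightarrow> expectation (\<lambda>w. Z w * arctan (Z w))"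
  proof (rule integral_dominated_convergence)
    show "integrable P (\<lambda>w. \<bar>Z w\<bar> * (pi / 2))" using intZ by simp
    show "AE w in P. (\<lambda>k. Z w * arctan (DF k w)) \<longlonglongrightarrow> Z w * arctan (Z w)"
      using D1(3)
    proof eventually_elim
      case (elim w)
      then have "(\<lambda>k. DF k w) \<longlonglongrightarrow> Z w" by (rule LIM_zero_cancel)
      then show ?case by (intro tendsto_intros)
    qed
    show "AE w in P. norm (Z w * arctan (DF k w)) \<le> \<bar>Z w\<bar> * (pi / 2)" for k
      unfolding real_norm_def abs_mult by (intro AE_I2 mult_left_mono abs_arctan_le) simp
  qed auto
  then have *: "expectation (\<lambda>w. Z w * arctan (Z w)) = 0"
    using zero by (simp add: LIMSEQ_const_iff)
  have pos: "0 \<le> x * arctan x" for x :: real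
    by (cases "0 \<le> x") (auto intro: mult_nonpos_nonpos)
  have "integrable P (\<lambda>w. Z w * arctan (Z w))"
  proof (rule Bochner_Integration.integrable_bound[OF integrable_mult_left[OF intZ, of "pi / 2"]])
    show "AE w in P. norm (Z w * arctan (Z w)) \<le> norm (Z w * (pi / 2))"
    proof (rule AE_I2)
      fix w
      have "\<bar>Z w\<bar> * \<bar>arctan (Z w)\<bar> \<le> \<bar>Z w\<bar> * (pi / 2)"
        by (intro mult_left_mono abs_arctan_le) simp
      then show "norm (Z w * arctan (Z w)) \<le> norm (Z w * (pi / 2))" by (simp add: abs_mult)
    qed
  qed simp
  then have "AE w in P. Z w * arctan (Z w) = 0"
    using integral_nonneg_eq_0_iff_AE[of P "\<lambda>w. Z w * arctan (Z w)"] pos * by auto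
  then show ?thesis by eventually_elim simp
qed

end

section \<open>The quadratic variation\<close>

definition quad_var :: "real \<Rightarrow> nat \<Rightarrow> (real \<Rightarrow> real) \<Rightarrow> real" where
  "quad_var T n x = (\<Sum>k<2 ^ n. (x (real (Suc k) * T / 2 ^ n) - x (real k * T / 2 ^ n))\<^sup>2)"

text \<open>The \<open>n\<close>-th dyadic sum has mean \<open>T * \<tau>\<close> and variance \<open>2 * (T * \<tau>)\<^sup>2 / 2 ^ n\<close>. As these
  variances are summable, the convergence is almost sure.\<close>

lemma (in wiener) quad_var_tendsto:
  assumes "0 < T" "0 < \<tau>"
  shows "AE w in P. (\<lambda>n. quad_var T n (\<lambda>t. w (t * \<tau>))) \<longlonglongrightarrow> T * \<tau>"
proof -
  define V where "V n w = quad_var T n (\<lambda>t. w (t * \<tau>))" for n and w :: "real \<Rightarrow> real"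
  have [measurable]: "V n \<in> borel_measurable P" for n
    unfolding V_def[abs_def] quad_var_def by measurable
  have second: "integrable P (\<lambda>w. (V n w - T * \<tau>)\<^sup>2) \<and> expectation (\<lambda>w. (V n w - T * \<tau>)\<^sup>2) = 2 * (T * \<tau>)\<^sup>2 * (1 / 2) ^ n" for n
  proof -
    define t where "t k = real k * T / 2 ^ n * \<tau>" for k
    define \<delta> where "\<delta> = T * \<tau> / 2 ^ n"
    have \<delta>: "\<delta> > 0" using assms by (simp add: \<delta>_def)
    have step: "t (Suc k) - t k = \<delta>" for k
      by (simp add: t_def \<delta>_def field_simps)
    have t0: "0 \<le> t k" for k using assms by (simp add: t_def)
    have tless: "t k < t (Suc k)" for k using step[of k] \<delta> by linarith
    have mono: "strict_mono t" by (intro strict_mono_Suc_iff[THEN iffD2] allI tless)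
    define D where "D k w = w (t (Suc k)) - w (t k)" for k and w :: "real \<Rightarrow> real"
    have ind: "indep_vars (\<lambda>_. borel) D {..<2 ^ n}"
      unfolding D_def[abs_def] by (rule increments_indep) (use t0 mono in \<open>auto simp: strict_mono_on_def strict_mono_def\<close>)
    have Dd: "distributed P lborel (D k) (normal_density 0 (sqrt \<delta>))" for k
      unfolding D_def[abs_def] step[of k, symmetric] by (rule increment_distributed[OF t0 tless])
    have sd: "sqrt \<delta> > 0" using \<delta> by simp
    note int = normal_integrable_power(1)[OF Dd sd] and mom = normal_moments[OF Dd sd]
    have s4: "sqrt \<delta> ^ 4 = \<delta>\<^sup>2" using \<delta> by (metis abs_of_pos numeral_Bit0 power2_eq_square power_add real_sqrt_abs2 real_sqrt_power power_mult_distrib)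
    define Y where "Y k w = (D k w)\<^sup>2 - \<delta>" for k w
    have Ysq: "(Y k w)\<^sup>2 = D k w ^ 4 - 2 * \<delta> * (D k w)\<^sup>2 + \<delta>\<^sup>2" for k w
      by (simp add: Y_def power2_eq_square power4_eq_xxxx algebra_simps)
    have Y: "integrable P (Y k)" "expectation (Y k) = 0" "integrable P (\<lambda>w. (Y k w)\<^sup>2)"
      "expectation (\<lambda>w. (Y k w)\<^sup>2) = 2 * \<delta>\<^sup>2" for k
      unfolding Ysq unfolding Y_def[abs_def]
      using int[of k 2] int[of k 4] mom[of k] \<delta> s4 by (simp_all add: prob_space power2_eq_square)
    have indY: "indep_vars (\<lambda>_. borel) Y {..<2 ^ n}"
      unfolding Y_def[abs_def] by (rule indep_vars_compose2[OF ind]) auto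
    have VY: "V n w - T * \<tau> = (\<Sum>k<2 ^ n. Y k w)" for w
      by (simp add: V_def quad_var_def Y_def D_def t_def sum_subtractf \<delta>_def)
    have "(\<Sum>k<2 ^ n. expectation (\<lambda>w. (Y k w)\<^sup>2)) = 2 ^ n * (2 * \<delta>\<^sup>2)"
      using Y(4) by simp
    also have "\<dots> = 2 * (T * \<tau>)\<^sup>2 * (1 / 2) ^ n"
      by (simp add: \<delta>_def power2_eq_square power_one_over field_simps)
    finally show ?thesis
      unfolding VY using indep_vars_sum_square[OF _ indY Y(1,3,2)] by simp
  qed
  have "AE w in P. (\<lambda>n. (V n w - T * \<tau>)\<^sup>2) \<longlonglongrightarrow> 0"
  proof (rule summable_L1_norms(3))
    have eq: "(\<integral>\<^sup>+ w. ennreal \<bar>(V n w - T * \<tau>)\<^sup>2\<bar> \<partial>P) = ennreal (2 * (T * \<tau>)\<^sup>2 * (1 / 2) ^ n)" for n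
      using second[of n] by (simp add: nn_integral_eq_integral)
    have "summable (\<lambda>n. 2 * (T * \<tau>)\<^sup>2 * (1 / 2) ^ n)"
      by (intro summable_mult summable_geometric) simp
    then have "(\<Sum>n. ennreal (2 * (T * \<tau>)\<^sup>2 * (1 / 2) ^ n)) \<noteq> top"
      by (rule ennreal_suminf_neq_top) simp
    then show "(\<Sum>n. \<integral>\<^sup>+ w. ennreal \<bar>(V n w - T * \<tau>)\<^sup>2\<bar> \<partial>P) < \<infinity>"
      unfolding eq by (simp only: infinity_ennreal_def less_top[symmetric] not_False_eq_True)
  qed simp
  then show ?thesis
    unfolding V_def
  proof eventually_elim
    case (elim w)
    then have "(\<lambda>n. sqrt ((quad_var T n (\<lambda>t. w (t * \<tau>)) - T * \<tau>)\<^sup>2)) \<longlonglongrightarrow> sqrt 0"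
      by (rule tendsto_real_sqrt)
    then show ?case
      by (simp add: tendsto_rabs_zero_iff LIM_zero_iff)
  qed
qed

section \<open>The moments of the random time\<close>

text \<open>The Gamma function has a positive minimum on \<open>[1, 2]\<close>, and \<open>Gamma (x + 1) = x * Gamma x\<close>
  propagates this bound to the right. Hence the coefficients of the Mittag-Leffler series are
  bounded.\<close>

lemma Gamma_bounded_below:
  obtains c :: real where "c > 0" "\<And>x. 1 \<le> x \<Longrightarrow> c \<le> Gamma x"
proof -
  have "continuous_on {1..2::real} Gamma"
    by (intro continuous_on_Gamma) (auto elim!: nonpos_Ints_cases)
  then obtain a :: real where a: "a \<in> {1..2}" "\<And>x. x \<in> {1..2} \<Longrightarrow> Gamma a \<le> Gamma x"
    using continuous_attains_inf[of "{1..2::real}" Gamma] by auto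
  have "\<forall>x. 1 \<le> x \<longrightarrow> x \<le> real n + 2 \<longrightarrow> Gamma a \<le> Gamma x" for n
  proof (induction n)
    case (Suc n)
    show ?case
    proof (intro allI impI)
      fix x :: real assume x: "1 \<le> x" "x \<le> real (Suc n) + 2"
      show "Gamma a \<le> Gamma x"
      proof (cases "x \<le> 2")
        case False
        then have "Gamma a \<le> Gamma (x - 1)" using Suc x by auto
        also have "\<dots> \<le> (x - 1) * Gamma (x - 1)"
        proof -
          have "0 < Gamma (x - 1)" using False by (intro Gamma_real_pos) simp
          from mult_right_mono[OF _ less_imp_le[OF this], of 1 "x - 1"] False
          show ?thesis by simp
        qed
        also have "\<dots> = Gamma x"
          using False Gamma_plus1[of "x - 1"] nonpos_Ints_nonpos[of "x - 1"] by force
        finally show ?thesis .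
      qed (use a x in auto)
    qed
  qed (use a in auto)
  moreover have "\<exists>n. x \<le> real n + 2" for x :: real
    using real_arch_simple[of x] by (meson add_increasing2 zero_le_numeral)
  ultimately have "Gamma a \<le> Gamma x" if "1 \<le> x" for x using that by blast
  then show thesis
    using a(1) by (intro that[of "Gamma a"]) (auto intro: Gamma_real_pos)
qed

text \<open>A \<open>k\<close>-th finite difference annihilates polynomials of degree below \<open>k\<close>. Pascal's rule writes a
  difference of order \<open>k + 1\<close> of \<open>x ^ m\<close> as a difference of order \<open>k\<close> of a polynomial of degree
  below \<open>m\<close>.\<close>

lemma alternating_binomial_sum_power:
  assumes "m < k"
  shows "(\<Sum>j\<le>k. (-1) ^ j * real (k choose j) * real j ^ m) = 0"
  using assms
proof (induction k arbitrary: m)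
  case (Suc k)
  let ?S = "\<lambda>f. \<Sum>j\<le>k. (-1) ^ j * real (k choose j) * f j"
  have pascal: "(\<Sum>j\<le>Suc k. (-1) ^ j * real (Suc k choose j) * f j) = ?S f - ?S (\<lambda>j. f (Suc j))" for f :: "nat \<Rightarrow> real"
  proof -
    have "(\<Sum>j\<le>Suc k. (-1) ^ j * real (Suc k choose j) * f j)
        = f 0 + (\<Sum>j\<le>k. (-1) ^ Suc j * (real (k choose j) + real (k choose Suc j)) * f (Suc j))"
      by (subst sum.atMost_Suc_shift) simp
    also have "\<dots> = f 0 + (\<Sum>j\<le>k. (-1) ^ Suc j * real (k choose Suc j) * f (Suc j)) - ?S (\<lambda>j. f (Suc j))"
    proof -
      have "(-1) ^ Suc j * (real (k choose j) + real (k choose Suc j)) * f (Suc j)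
          = (-1) ^ Suc j * real (k choose Suc j) * f (Suc j) - (-1) ^ j * real (k choose j) * f (Suc j)" for j
        by (simp add: algebra_simps)
      then show ?thesis by (simp add: sum_subtractf)
    qed
    also have "f 0 + (\<Sum>j\<le>k. (-1) ^ Suc j * real (k choose Suc j) * f (Suc j))
        = (\<Sum>j\<le>Suc k. (-1) ^ j * real (k choose j) * f j)"
      by (subst sum.atMost_Suc_shift) simp
    also have "\<dots> = ?S f" by simp
    finally show ?thesis .
  qed
  have "(\<Sum>j\<le>Suc k. (-1) ^ j * real (Suc k choose j) * real j ^ m)
      = ?S (\<lambda>j. real j ^ m) - ?S (\<lambda>j. (real j + 1) ^ m)"
    unfolding pascal by (simp add: add.commute)
  also have "?S (\<lambda>j. (real j + 1) ^ m) = ?S (\<lambda>j. \<Sum>i\<le>m. real (m choose i) * real j ^ i)"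
    by (simp add: binomial_ring)
  also have "\<dots> = (\<Sum>i\<le>m. real (m choose i) * ?S (\<lambda>j. real j ^ i))"
    unfolding sum_distrib_left by (subst sum.swap) (simp add: mult_ac)
  also have "\<dots> = ?S (\<lambda>j. real j ^ m) + (\<Sum>i<m. real (m choose i) * ?S (\<lambda>j. real j ^ i))"
    by (simp add: lessThan_Suc_atMost[symmetric])
  also have "(\<Sum>i<m. real (m choose i) * ?S (\<lambda>j. real j ^ i)) = 0"
    using Suc by (intro sum.neutral) auto
  finally show ?case by simp
qed simp

text \<open>The \<open>k\<close>-th finite difference with step \<open>s\<close> of a power series with bounded
  coefficients is of order \<open>s ^ k\<close>, since it
  annihilates the first \<open>k\<close> terms of the series. With \<open>s * k \<le> 1 / 2\<close> the remaining terms are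
  dominated by a geometric series.\<close>

lemma power_series_difference_bound:
  fixes a :: "nat \<Rightarrow> real"
  assumes a: "\<And>m. \<bar>a m\<bar> \<le> C" and s: "0 \<le> s" "s * real k \<le> 1 / 2"
  shows "\<bar>\<Sum>j\<le>k. (-1) ^ j * real (k choose j) * (\<Sum>m. (- (real j * s)) ^ m * a m)\<bar> \<le> C * 2 ^ k * 2 * (s * real k) ^ k"
proof -
  have C0: "0 \<le> C" using a[of 0] by linarith
  have js: "\<bar>- (real j * s)\<bar> \<le> s * real k" if "j \<le> k" for j
    using that s(1) by (simp add: abs_mult mult.commute mult_left_mono)
  have sm: "summable (\<lambda>m. (- (real j * s)) ^ m * a m)" if "j \<le> k" for j
  proof (rule summable_comparison_test')
    show "summable (\<lambda>m. C * (1 / 2) ^ m)" by (intro summable_mult summable_geometric) simp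
    fix m :: nat assume "0 \<le> m"
    have "\<bar>- (real j * s)\<bar> ^ m \<le> (1 / 2) ^ m"
      using js[OF that] s(2) by (intro power_mono) auto
    then have "\<bar>- (real j * s)\<bar> ^ m * \<bar>a m\<bar> \<le> (1 / 2) ^ m * C"
      by (intro mult_mono a) auto
    then show "norm ((- (real j * s)) ^ m * a m) \<le> C * (1 / 2) ^ m"
      unfolding real_norm_def abs_mult[of "(- (real j * s)) ^ m"] power_abs by (simp only: mult.commute)
  qed
  define d where "d m = (\<Sum>j\<le>k. (-1) ^ j * real (k choose j) * real j ^ m)" for m
  have d0: "d m = 0" if "m < k" for m
    unfolding d_def by (rule alternating_binomial_sum_power[OF that])
  have dk: "\<bar>d m\<bar> \<le> 2 ^ k * real k ^ m" for m
  proof -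
    have "\<bar>d m\<bar> \<le> (\<Sum>j\<le>k. real (k choose j) * real k ^ m)"
      unfolding d_def by (rule order_trans[OF sum_abs]) (auto intro!: sum_mono mult_left_mono power_mono simp: abs_mult)
    also have "\<dots> = 2 ^ k * real k ^ m"
      unfolding sum_distrib_right[symmetric] by (simp add: choose_row_sum flip: of_nat_sum)
    finally show ?thesis .
  qed
  have "(\<Sum>j\<le>k. (-1) ^ j * real (k choose j) * (\<Sum>m. (- (real j * s)) ^ m * a m))
      = (\<Sum>j\<le>k. \<Sum>m. (-1) ^ j * real (k choose j) * ((- (real j * s)) ^ m * a m))"
    using sm by (intro sum.cong refl suminf_mult[symmetric]) auto
  also have "\<dots> = (\<Sum>m. \<Sum>j\<le>k. (-1) ^ j * real (k choose j) * ((- (real j * s)) ^ m * a m))"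
    using sm by (intro suminf_sum[symmetric] summable_mult) auto
  also have "(\<lambda>m. \<Sum>j\<le>k. (-1) ^ j * real (k choose j) * ((- (real j * s)) ^ m * a m)) = (\<lambda>m. a m * (- s) ^ m * d m)"
  proof
    fix m
    have "(- (real j * s)) ^ m = (- s) ^ m * real j ^ m" for j
      by (simp add: power_mult_distrib[symmetric] mult.commute)
    then show "(\<Sum>j\<le>k. (-1) ^ j * real (k choose j) * ((- (real j * s)) ^ m * a m)) = a m * (- s) ^ m * d m"
      by (simp add: d_def sum_distrib_left mult_ac)
  qed
  finally have eq: "(\<Sum>j\<le>k. (-1) ^ j * real (k choose j) * (\<Sum>m. (- (real j * s)) ^ m * a m)) = (\<Sum>m. a m * (- s) ^ m * d m)" .
  have le: "\<bar>a m * (- s) ^ m * d m\<bar> \<le> C * 2 ^ k * (s * real k) ^ k * (1 / 2) ^ (m - k)" for m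
  proof (cases "m < k")
    case False
    have "\<bar>a m * (- s) ^ m * d m\<bar> \<le> C * s ^ m * (2 ^ k * real k ^ m)"
      unfolding abs_mult using s(1) by (intro mult_mono a dk) (auto simp: power_abs C0)
    also have "\<dots> = C * 2 ^ k * (s * real k) ^ m" by (simp add: power_mult_distrib)
    also have "(s * real k) ^ m = (s * real k) ^ k * (s * real k) ^ (m - k)"
      using False by (simp flip: power_add)
    also have "C * 2 ^ k * ((s * real k) ^ k * (s * real k) ^ (m - k)) \<le> C * 2 ^ k * ((s * real k) ^ k * (1 / 2) ^ (m - k))"
      using s C0 by (intro mult_left_mono power_mono) auto
    finally show ?thesis by (simp add: mult_ac)
  qed (use d0 s C0 in simp)
  have geo: "(\<lambda>m. (1 / 2 :: real) ^ m) sums 2" using geometric_sums[of "1 / 2 :: real"] by simp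
  have le': "\<bar>a (m + k) * (- s) ^ (m + k) * d (m + k)\<bar> \<le> C * 2 ^ k * (s * real k) ^ k * (1 / 2) ^ m" for m
    using le[of "m + k"] by simp
  have sm': "summable (\<lambda>m. \<bar>a (m + k) * (- s) ^ (m + k) * d (m + k)\<bar>)"
    by (rule summable_comparison_test'[of "\<lambda>m. C * 2 ^ k * (s * real k) ^ k * (1 / 2) ^ m"])
       (use le' geo in \<open>auto intro!: summable_mult sums_summable\<close>)
  have "(\<Sum>m. a m * (- s) ^ m * d m) = (\<Sum>m. a (m + k) * (- s) ^ (m + k) * d (m + k))"
    using suminf_split_initial_segment[of "\<lambda>m. a m * (- s) ^ m * d m" k] d0
      summable_iff_shift[of "\<lambda>m. a m * (- s) ^ m * d m" k] summable_rabs_cancel[OF sm'] by simp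
  also have "\<bar>\<dots>\<bar> \<le> (\<Sum>m. \<bar>a (m + k) * (- s) ^ (m + k) * d (m + k)\<bar>)"
    by (rule summable_rabs[OF sm'])
  also have "\<dots> \<le> (\<Sum>m. C * 2 ^ k * (s * real k) ^ k * (1 / 2) ^ m)"
    using le' sm' geo by (intro suminf_le) (auto intro!: summable_mult sums_summable)
  also have "\<dots> = C * 2 ^ k * 2 * (s * real k) ^ k"
    using geo by (simp add: suminf_mult sums_summable sums_iff)
  finally show ?thesis unfolding eq .
qed


lemma nn_integral_time_law:
  assumes [measurable]: "M \<in> borel_measurable borel" "f \<in> borel_measurable borel"
  shows "(\<integral>\<^sup>+ \<tau>. f \<tau> \<partial>time_law M) = (\<integral>\<^sup>+ \<tau>. ennreal (M \<tau>) * f \<tau> * indicator {0..} \<tau> \<partial>lborel)"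
proof -
  have m: "(\<lambda>\<tau>. ennreal (M \<tau>)) \<in> borel_measurable (restrict_space lborel {0..})"
    "f \<in> borel_measurable (restrict_space lborel {0..})"
    by (intro measurable_restrict_space1; simp)+
  show ?thesis
    unfolding time_law_def using m
    by (simp add: nn_integral_density nn_integral_restrict_space)
qed

lemma space_time_law: "space (time_law M) = {0..}"
  by (simp add: time_law_def space_restrict_space)

lemma sets_time_law: "sets (time_law M) = sets (restrict_space borel {0..})"
  unfolding time_law_def sets_density by (rule sets_restrict_space_cong[OF sets_lborel])

lemma measurable_time_law: "f \<in> measurable borel N \<Longrightarrow> f \<in> measurable (time_law M) N"
  by (subst measurable_cong_sets[OF sets_time_law refl]) (rule measurable_restrict_space1)

lemma AE_time_law_pos:
  assumes [measurable]: "M \<in> borel_measurable borel"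
  shows "AE \<tau> in time_law M. 0 < \<tau>"
proof -
  have "AE \<tau> in lborel. (\<tau>::real) \<in> {0..} \<longrightarrow> 0 < \<tau>"
    using AE_lborel_singleton[of "0::real"] by eventually_elim auto
  then have "AE \<tau> in restrict_space lborel {0::real..}. 0 < \<tau>"
    by (subst AE_restrict_space_iff) auto
  moreover have "(\<lambda>\<tau>. ennreal (M \<tau>)) \<in> borel_measurable (restrict_space lborel {0..})"
    by (intro measurable_restrict_space1) simp
  ultimately show ?thesis
    unfolding time_law_def by (subst AE_density) auto
qed

text \<open>The total mass is the Laplace transform at \<open>0\<close>. For the moments, \<open>E[(1 - exp (- s * \<tau>)) ^ k]\<close> is a
  \<open>k\<close>-th finite difference of the Laplace transform, hence of order \<open>s ^ k\<close>; divided by \<open>s ^ k\<close>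
  its integrand tends to \<open>\<tau> ^ k\<close> as \<open>s \<rightarrow> 0\<close>, and Fatou's lemma applies.\<close>

lemma
  assumes M: "mittag_leffler_density \<beta> M" and \<beta>: "0 < \<beta>"
  shows prob_space_time_law: "prob_space (time_law M)"
    and integrable_power_time_law: "integrable (time_law M) (\<lambda>\<tau>. \<tau> ^ k)"
proof -
  have meas[measurable]: "M \<in> borel_measurable borel" and nonneg: "\<And>\<tau>. 0 \<le> \<tau> \<Longrightarrow> 0 \<le> M \<tau>"
    and int: "\<And>s. 0 \<le> s \<Longrightarrow> set_integrable lborel {0..} (\<lambda>\<tau>. exp (- s * \<tau>) * M \<tau>)"
    and lap: "\<And>s. 0 \<le> s \<Longrightarrow> (LBINT \<tau>:{0..}. exp (- s * \<tau>) * M \<tau>) = mittag_leffler \<beta> (- s)"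
    using M unfolding mittag_leffler_density_def by blast+
  have nn: "(\<integral>\<^sup>+ \<tau>. ennreal (f \<tau>) \<partial>time_law M) = ennreal (LBINT \<tau>:{0..}. f \<tau> * M \<tau>)"
    if [measurable]: "f \<in> borel_measurable borel" and f: "\<And>\<tau>. 0 \<le> \<tau> \<Longrightarrow> 0 \<le> f \<tau>"
      and i: "set_integrable lborel {0..} (\<lambda>\<tau>. f \<tau> * M \<tau>)" for f
  proof -
    have "(\<integral>\<^sup>+ \<tau>. ennreal (f \<tau>) \<partial>time_law M) = (\<integral>\<^sup>+ \<tau>. ennreal (indicator {0..} \<tau> *\<^sub>R (f \<tau> * M \<tau>)) \<partial>lborel)"
      by (subst nn_integral_time_law)
         (auto intro!: nn_integral_cong simp: ennreal_mult[symmetric] nonneg f mult.commute split: split_indicator)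
    also have "\<dots> = ennreal (LBINT \<tau>:{0..}. f \<tau> * M \<tau>)"
      unfolding set_lebesgue_integral_def using i nonneg f
      by (intro nn_integral_eq_integral) (auto simp: set_integrable_def split: split_indicator)
    finally show ?thesis .
  qed
  have "(\<lambda>n. 0 ^ n / Gamma (\<beta> * real n + 1)) = (\<lambda>n. if n = 0 then 1 else 0 :: real)"
    by auto
  then have ml0: "mittag_leffler \<beta> 0 = 1"
    using suminf_finite[of "{0::nat}" "\<lambda>n. if n = 0 then 1 else 0 :: real"]
    by (simp add: mittag_leffler_def)
  have "(\<integral>\<^sup>+ \<tau>. ennreal 1 \<partial>time_law M) = ennreal 1"
    using nn[of "\<lambda>_. 1"] int[of 0] lap[of 0] ml0 by simp
  then show P: "prob_space (time_law M)"
    by (intro prob_spaceI) simp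
  obtain c :: real where c: "c > 0" "\<And>x. 1 \<le> x \<Longrightarrow> c \<le> Gamma x"
    using Gamma_bounded_below by blast
  define a where "a m = 1 / Gamma (\<beta> * real m + 1)" for m
  have a: "\<bar>a m\<bar> \<le> 1 / c" for m
    using c(2)[of "\<beta> * real m + 1"] c(1) \<beta> by (simp add: a_def frac_le)
  have ml: "mittag_leffler \<beta> z = (\<Sum>m. z ^ m * a m)" for z
    by (simp add: mittag_leffler_def a_def)
  define B where "B = 1 / c * 2 ^ k * 2 * real k ^ k"
  have bound: "(\<integral>\<^sup>+ \<tau>. ennreal (((1 - exp (- s * \<tau>)) / s) ^ k) \<partial>time_law M) \<le> ennreal B"
    if s: "0 < s" "s * real k \<le> 1 / 2" for s
  proof -
    have expand: "((1 - exp (- s * \<tau>)) / s) ^ k * M \<tau>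
        = (\<Sum>j\<le>k. (-1) ^ j * real (k choose j) / s ^ k * (exp (- (real j * s) * \<tau>) * M \<tau>))" for \<tau>
    proof -
      have "(1 - exp (- s * \<tau>)) ^ k = (\<Sum>j\<le>k. real (k choose j) * (- exp (- s * \<tau>)) ^ j)"
        using binomial_ring[of "- exp (- s * \<tau>)" 1 k] by simp
      also have "\<dots> = (\<Sum>j\<le>k. (-1) ^ j * real (k choose j) * exp (- (real j * s) * \<tau>))"
        by (intro sum.cong refl) (simp add: power_minus[of "exp _"] exp_of_nat_mult[symmetric] mult_ac)
      finally have pow: "(1 - exp (- s * \<tau>)) ^ k = (\<Sum>j\<le>k. (-1) ^ j * real (k choose j) * exp (- (real j * s) * \<tau>))" .
      show ?thesis
        unfolding power_divide pow sum_divide_distrib sum_distrib_right by (intro sum.cong refl) simp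
    qed
    have ji: "set_integrable lborel {0..} (\<lambda>\<tau>. (-1) ^ j * real (k choose j) / s ^ k * (exp (- (real j * s) * \<tau>) * M \<tau>))" for j
      using s by (intro set_integrable_mult_right int) simp
    have i: "set_integrable lborel {0..} (\<lambda>\<tau>. ((1 - exp (- s * \<tau>)) / s) ^ k * M \<tau>)"
      unfolding expand set_integrable_def scaleR_sum_right
      using ji by (intro Bochner_Integration.integrable_sum) (simp only: set_integrable_def)
    have "(LBINT \<tau>:{0..}. ((1 - exp (- s * \<tau>)) / s) ^ k * M \<tau>)
       = (\<Sum>j\<le>k. (-1) ^ j * real (k choose j) / s ^ k * mittag_leffler \<beta> (- (real j * s)))"
    proof -
      have "(LBINT \<tau>:{0..}. ((1 - exp (- s * \<tau>)) / s) ^ k * M \<tau>)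
         = (\<Sum>j\<le>k. LBINT \<tau>:{0..}. (-1) ^ j * real (k choose j) / s ^ k * (exp (- (real j * s) * \<tau>) * M \<tau>))"
        unfolding expand set_lebesgue_integral_def scaleR_sum_right
        using ji by (intro Bochner_Integration.integral_sum) (simp only: set_integrable_def)
      also have "\<dots> = (\<Sum>j\<le>k. (-1) ^ j * real (k choose j) / s ^ k * mittag_leffler \<beta> (- (real j * s)))"
      proof (intro sum.cong refl)
        fix j
        have "(LBINT \<tau>:{0..}. exp (- (real j * s) * \<tau>) * M \<tau>) = mittag_leffler \<beta> (- (real j * s))"
          using s by (intro lap) simp
        then show "(LBINT \<tau>:{0..}. (-1) ^ j * real (k choose j) / s ^ k * (exp (- (real j * s) * \<tau>) * M \<tau>))
            = (-1) ^ j * real (k choose j) / s ^ k * mittag_leffler \<beta> (- (real j * s))"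
          by (simp only: set_integral_mult_right)
      qed
      finally show ?thesis .
    qed
    also have "\<dots> = (\<Sum>j\<le>k. (-1) ^ j * real (k choose j) * (\<Sum>m. (- (real j * s)) ^ m * a m)) / s ^ k"
      unfolding ml by (simp add: sum_divide_distrib)
    also have "\<dots> \<le> (1 / c * 2 ^ k * 2 * (s * real k) ^ k) / s ^ k"
      using s by (intro divide_right_mono order_trans[OF abs_ge_self power_series_difference_bound] a) auto
    also have "\<dots> = B" using s by (simp add: B_def power_mult_distrib)
    finally have le: "(LBINT \<tau>:{0..}. ((1 - exp (- s * \<tau>)) / s) ^ k * M \<tau>) \<le> B" .
    have "(\<integral>\<^sup>+ \<tau>. ennreal (((1 - exp (- s * \<tau>)) / s) ^ k) \<partial>time_law M)
        = ennreal (LBINT \<tau>:{0..}. ((1 - exp (- s * \<tau>)) / s) ^ k * M \<tau>)"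
      using i s by (intro nn) auto
    then show ?thesis using le by (simp add: ennreal_leI)
  qed
  \<comment> \<open>The shift by \<open>2 * k + 1\<close> ensures \<open>s n * k \<le> 1 / 2\<close> from the start.\<close>
  define s where "s n = inverse (real (Suc (n + (2 * k + 1))))" for n
  have s: "0 < s n" "s n * real k \<le> 1 / 2" for n
    by (auto simp: s_def divide_simps)
  have s_lim: "filterlim s (at 0) sequentially"
  proof -
    have "s \<longlonglongrightarrow> 0"
      unfolding s_def by (rule LIMSEQ_ignore_initial_segment[OF LIMSEQ_inverse_real_of_nat])
    then show ?thesis using s(1) by (intro filterlim_atI) (auto simp: less_imp_neq[symmetric])
  qed
  have lim: "(\<lambda>n. ((1 - exp (- s n * \<tau>)) / s n) ^ k) \<longlonglongrightarrow> \<tau> ^ k" for \<tau>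
  proof -
    have "((\<lambda>u. - exp (- u * \<tau>)) has_real_derivative \<tau>) (at 0)"
      by (auto intro!: derivative_eq_intros)
    then have "((\<lambda>u. (1 - exp (- u * \<tau>)) / u) \<longlongrightarrow> \<tau>) (at 0)"
      by (simp add: DERIV_def)
    then show ?thesis
      using filterlim_compose[OF _ s_lim] by (intro tendsto_power) blast
  qed
  have "(\<integral>\<^sup>+ \<tau>. ennreal (\<tau> ^ k) \<partial>time_law M)
      = (\<integral>\<^sup>+ \<tau>. liminf (\<lambda>n. ennreal (((1 - exp (- s n * \<tau>)) / s n) ^ k)) \<partial>time_law M)"
    using lim by (intro nn_integral_cong lim_imp_Liminf[symmetric] tendsto_ennrealI) auto
  also have "\<dots> \<le> liminf (\<lambda>n. \<integral>\<^sup>+ \<tau>. ennreal (((1 - exp (- s n * \<tau>)) / s n) ^ k) \<partial>time_law M)"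
    by (intro nn_integral_liminf measurable_time_law) measurable
  also have "\<dots> \<le> liminf (\<lambda>n. ennreal B)"
    using bound s by (intro Liminf_mono always_eventually) auto
  also have "\<dots> = ennreal B" by (simp add: Liminf_const)
  also have "\<dots> < \<infinity>" by simp
  finally have fin: "(\<integral>\<^sup>+ \<tau>. ennreal (\<tau> ^ k) \<partial>time_law M) < \<infinity>" .
  show "integrable (time_law M) (\<lambda>\<tau>. \<tau> ^ k)"
  proof (rule integrableI_nonneg)
    show "(\<lambda>\<tau>. \<tau> ^ k) \<in> borel_measurable (time_law M)" by (intro measurable_time_law) simp
    show "AE \<tau> in time_law M. 0 \<le> \<tau> ^ k" by (rule AE_I2) (simp add: space_time_law)
  qed (rule fin)
qed

section \<open>The time-changed process\<close>

lemma dir_deriv_cylinder: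
  assumes f: "f \<in> Cb_infinity n"
  shows "dir_deriv h (\<lambda>(w, \<tau>). f (\<lambda>i. w (t i * \<tau>))) (w, \<tau>)
    = (\<Sum>i<n. h (t i * \<tau>) * partial_deriv i f (\<lambda>i. w (t i * \<tau>)))"
proof -
  have "((\<lambda>\<epsilon>. f (\<lambda>i. w (t i * \<tau>) + \<epsilon> * h (t i * \<tau>))) has_real_derivative
      (\<Sum>i<n. h (t i * \<tau>) * partial_deriv i f (\<lambda>i. w (t i * \<tau>) + 0 * h (t i * \<tau>)))) (at 0)"
    by (rule C1_boundedD(5)[OF Cb_infinity_C1_bounded[OF f]])
  then show ?thesis
    unfolding dir_deriv_def by (auto simp: DERIV_def intro!: tendsto_Lim)
qed

lemma wiener_space_continuous:
  assumes "w \<in> wiener_space"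
  shows "continuous_on UNIV w"
proof -
  have c: "continuous_on {0..} w" using assms by (simp add: wiener_space_def)
  have "continuous_on UNIV (\<lambda>t::real. max 0 t)" by (intro continuous_intros)
  then have "continuous_on UNIV (\<lambda>t. w (max 0 t))"
    by (rule continuous_on_compose2[OF c]) auto
  also have "(\<lambda>t. w (max 0 t)) = w"
  proof
    fix t show "w (max 0 t) = w t"
      using assms by (cases "t < 0") (simp_all add: wiener_space_def max_def)
  qed
  finally show ?thesis .
qed

lemma (in wiener) emeasure_P: "emeasure P (space P) = 1"
  by (rule emeasure_space_1)

text \<open>By continuity of the paths, evaluation at a random time is the limit of evaluations at random
  times with countably many values.\<close>

lemma (in wiener) measurable_eval_random_time:
  assumes [measurable]: "u \<in> borel_measurable (P \<Otimes>\<^sub>M N)"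
  shows "(\<lambda>x. fst x (u x)) \<in> borel_measurable (P \<Otimes>\<^sub>M N)"
proof (rule borel_measurable_LIMSEQ_real)
  define r where "r n x = real_of_int \<lfloor>real (Suc n) * u x\<rfloor> / real (Suc n)" for n x
  show "(\<lambda>x. fst x (r n x)) \<in> borel_measurable (P \<Otimes>\<^sub>M N)" for n
    unfolding r_def
    by (rule measurable_compose_countable[of "\<lambda>i x. fst x (real_of_int i / real (Suc n))" _ _ "\<lambda>x. \<lfloor>real (Suc n) * u x\<rfloor>"])
       (auto intro!: measurable_compose[OF measurable_fst measurable_eval])
  fix x assume "x \<in> space (P \<Otimes>\<^sub>M N)"
  then have "fst x \<in> wiener_space" by (auto simp: space_pair_measure space_P)
  then have c: "continuous_on UNIV (fst x)" by (rule wiener_space_continuous)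
  have "(\<lambda>n. r n x - u x) \<longlonglongrightarrow> 0"
  proof (rule tendsto_0_le[OF LIMSEQ_inverse_real_of_nat, of _ 1], rule always_eventually, rule allI)
    fix n
    have "r n x \<le> u x" "u x < r n x + 1 / real (Suc n)"
      using of_int_floor_le[of "real (Suc n) * u x"] real_of_int_floor_add_one_gt[of "real (Suc n) * u x"]
      by (simp_all add: r_def field_simps)
    then show "norm (r n x - u x) \<le> norm (inverse (real (Suc n))) * 1"
      by (simp add: inverse_eq_divide)
  qed
  then have "(\<lambda>n. r n x) \<longlonglongrightarrow> u x" by (rule LIM_zero_cancel)
  then show "(\<lambda>n. fst x (r n x)) \<longlonglongrightarrow> fst x (u x)"
    using continuous_on_tendsto_compose[OF c] by simp
qed

text \<open>Where \<open>\<bar>u\<bar>\<close> exceeds a level \<open>d\<close>, it is at most \<open>d powr (1 - p) * \<bar>u\<bar> powr p\<close>; elsewhere it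
  contributes at most \<open>d\<close> to the integral.\<close>

lemma (in prob_space) L1_tendsto_if_Lp_tendsto:
  fixes u :: "nat \<Rightarrow> 'a \<Rightarrow> real"
  assumes [measurable]: "\<And>n. u n \<in> borel_measurable M" and p: "1 \<le> p"
    and lim: "(\<lambda>n. \<integral>\<^sup>+ x. ennreal (\<bar>u n x\<bar> powr p) \<partial>M) \<longlonglongrightarrow> 0"
  shows "(\<lambda>n. \<integral>\<^sup>+ x. ennreal \<bar>u n x\<bar> \<partial>M) \<longlonglongrightarrow> 0"
proof (rule order_tendstoI)
  fix e :: ennreal assume "0 < e"
  then obtain r where r: "0 < r" "ennreal r < e"
    by (metis dense ennreal_cases ennreal_less_zero_iff less_trans not_less_iff_gr_or_eq top_greatest leD)
  define d where "d = r / 2"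
  define c where "c = d powr (1 - p)"
  have d: "0 < d" "0 < c" using r by (auto simp: d_def c_def)
  have pw: "\<bar>y\<bar> \<le> d + c * \<bar>y\<bar> powr p" for y :: real
  proof (cases "\<bar>y\<bar> \<le> d")
    case False
    then have y: "d < \<bar>y\<bar>" by simp
    have "\<bar>y\<bar> = \<bar>y\<bar> powr (1 - p) * \<bar>y\<bar> powr p"
      using y d by (simp flip: powr_add)
    also have "\<dots> \<le> c * \<bar>y\<bar> powr p"
      unfolding c_def using y d p by (intro mult_right_mono powr_mono2') auto
    finally show ?thesis using d by linarith
  qed (use d in \<open>auto intro: add_increasing2\<close>)
  have "0 < ennreal (d / c)" using d by simp
  then have "\<forall>\<^sub>F n in sequentially. (\<integral>\<^sup>+ x. ennreal (\<bar>u n x\<bar> powr p) \<partial>M) < ennreal (d / c)"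
    using lim by (rule order_tendstoD(2)[rotated])
  then show "\<forall>\<^sub>F n in sequentially. (\<integral>\<^sup>+ x. ennreal \<bar>u n x\<bar> \<partial>M) < e"
  proof eventually_elim
    case (elim n)
    have "(\<integral>\<^sup>+ x. ennreal \<bar>u n x\<bar> \<partial>M) \<le> (\<integral>\<^sup>+ x. ennreal d + ennreal c * ennreal (\<bar>u n x\<bar> powr p) \<partial>M)"
      using pw d by (intro nn_integral_mono) (simp add: ennreal_leI flip: ennreal_mult ennreal_plus)
    also have "\<dots> = ennreal d + ennreal c * (\<integral>\<^sup>+ x. ennreal (\<bar>u n x\<bar> powr p) \<partial>M)"
      by (simp add: nn_integral_add nn_integral_cmult emeasure_space_1)
    also have "\<dots> \<le> ennreal d + ennreal c * ennreal (d / c)"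
      using elim by (intro add_left_mono mult_left_mono) auto
    also have "\<dots> = ennreal r"
      using d by (simp add: d_def flip: ennreal_mult ennreal_plus)
    finally show ?case using r by simp
  qed
qed simp

lemma X_algebra_space: "space (X_algebra T) = wiener_space \<times> {0..}"
  unfolding X_algebra_def by (rule space_measure_of) auto

lemma X_algebra_sets: "sets (X_algebra T) = sigma_sets (wiener_space \<times> {0..})
     {X_proc t -` B \<inter> (wiener_space \<times> {0..}) | t B. t \<in> {0..T} \<and> B \<in> sets borel}"
  unfolding X_algebra_def by (rule sets_measure_of) auto

lemma measurable_X_proc:
  assumes "t \<in> {0..T}"
  shows "X_proc t \<in> borel_measurable (X_algebra T)"
  using assms by (intro measurableI) (auto simp: X_algebra_space X_algebra_sets intro!: sigma_sets.Basic)

locale time_changed = wiener P for P +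
  fixes \<beta> T :: real and M :: "real \<Rightarrow> real"
  assumes \<beta>: "0 < \<beta>" and T: "0 < T" and M: "mittag_leffler_density \<beta> M"
begin

abbreviation "N \<equiv> time_law M"
abbreviation "Q \<equiv> P \<Otimes>\<^sub>M N"

sublocale N: prob_space N by (rule prob_space_time_law[OF M \<beta>])
sublocale pair_prob_space P N ..

lemma space_Q: "space Q = wiener_space \<times> {0..}"
  by (simp add: space_pair_measure space_P space_time_law)

lemma measurable_snd_Q[measurable]: "snd \<in> borel_measurable Q"
  using measurable_compose[OF measurable_snd measurable_time_law[of "\<lambda>x. x" borel]] by simp

lemma measurable_X_proc_Q[measurable]: "X_proc t \<in> borel_measurable Q"
  using measurable_eval_random_time[of "\<lambda>x. t * snd x" N] by (simp add: X_proc_def case_prod_unfold)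

lemma X_algebra_measurable_Q:
  assumes "f \<in> measurable (X_algebra T) B"
  shows "f \<in> measurable Q B"
proof (rule measurableI)
  show "f x \<in> space B" if "x \<in> space Q" for x
    using assms that by (auto simp: measurable_def X_algebra_space space_Q)
  fix A assume "A \<in> sets B"
  then have "f -` A \<inter> space (X_algebra T) \<in> sets (X_algebra T)" using assms by (rule measurable_sets[rotated])
  also have "sets (X_algebra T) \<subseteq> sets Q"
    unfolding X_algebra_sets space_Q[symmetric]
    by (rule sets.sigma_sets_subset) (auto intro: measurable_sets[OF measurable_X_proc_Q])
  finally show "f -` A \<inter> space Q \<in> sets Q" by (simp add: space_Q X_algebra_space)
qed

lemma AE_Q_swap:
  assumes "Measurable.pred Q R" "AE \<tau> in N. AE w in P. R (w, \<tau>)"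
  shows "AE x in Q. R x"
proof -
  have "{x \<in> space Q. R x} \<in> sets Q" using assms(1) by (simp add: pred_def)
  then show ?thesis
    using assms(2) by (intro AE_pair_measure AE_commute[THEN iffD2]) auto
qed

text \<open>The time \<open>\<tau>\<close> read off from the path \<open>t \<mapsto> w (t * \<tau>)\<close> alone, as its quadratic variation per unit of
  time. Being defined through \<open>X_proc t\<close> with \<open>t\<close> in \<open>[0, T]\<close>, it is \<open>X_algebra T\<close>-measurable.\<close>

definition recovered_time :: "(real \<Rightarrow> real) \<times> real \<Rightarrow> real" where
  "recovered_time x = lim (\<lambda>n. quad_var T n (\<lambda>t. X_proc t x)) / T"

lemma measurable_recovered_time: "recovered_time \<in> borel_measurable (X_algebra T)"
proof -
  have "(\<lambda>x. quad_var T n (\<lambda>t. X_proc t x)) \<in> borel_measurable (X_algebra T)" for n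
    unfolding quad_var_def
  proof (intro borel_measurable_sum borel_measurable_power borel_measurable_diff measurable_X_proc)
    fix k :: nat assume "k \<in> {..<2 ^ n}"
    then have "real (Suc k) \<le> 2 ^ n" by (metis Suc_leI lessThan_iff of_nat_le_iff of_nat_numeral of_nat_power)
    then have "real (Suc k) * T \<le> 2 ^ n * T" "real k * T \<le> 2 ^ n * T"
      using T by (intro mult_right_mono; linarith)+
    then show "real (Suc k) * T / 2 ^ n \<in> {0..T}" "real k * T / 2 ^ n \<in> {0..T}"
      using T by (simp_all add: divide_le_eq mult.commute)
  qed
  then show ?thesis
    unfolding recovered_time_def[abs_def] by (intro borel_measurable_divide borel_measurable_lim_metric) auto
qed

lemma recovered_time_eq: "AE x in Q. recovered_time x = snd x"
proof (rule AE_Q_swap)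
  show "Measurable.pred Q (\<lambda>x. recovered_time x = snd x)"
    using X_algebra_measurable_Q[OF measurable_recovered_time] by measurable
  have "AE \<tau> in N. 0 < \<tau>"
    using M by (intro AE_time_law_pos) (simp add: mittag_leffler_density_def)
  then show "AE \<tau> in N. AE w in P. recovered_time (w, \<tau>) = snd (w, \<tau>)"
  proof eventually_elim
    case (elim \<tau>)
    from quad_var_tendsto[OF T elim] show ?case
    proof eventually_elim
      case (elim w)
      then have "lim (\<lambda>n. quad_var T n (\<lambda>t. w (t * \<tau>))) = T * \<tau>" by (rule limI)
      then show ?case using T by (simp add: recovered_time_def X_proc_def)
    qed
  qed
qed

lemma continuous_cylinder_measurable:
  fixes n :: nat
  assumes g: "continuous_on UNIV g" and loc: "\<And>x y. (\<And>i. i < n \<Longrightarrow> x i = y i) \<Longrightarrow> g x = g y"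
    and t: "\<And>i. i < n \<Longrightarrow> 0 < t i \<and> t i \<le> T"
  shows "(\<lambda>x. g (\<lambda>i. X_proc (t i) x)) \<in> borel_measurable (X_algebra T)"
proof -
  \<comment> \<open>The times with index at least \<open>n\<close> are arbitrary and may lie outside \<open>[0, T]\<close>.\<close>
  define t' where "t' i = (if i < n then t i else 0)" for i
  have "(\<lambda>x i. X_proc (t' i) x) \<in> measurable (X_algebra T) borel"
  proof (rule measurable_coordinatewise_then_product)
    show "(\<lambda>x. X_proc (t' i) x) \<in> borel_measurable (X_algebra T)" for i
      using t[of i] T by (intro measurable_X_proc) (auto simp: t'_def)
  qed
  from measurable_compose[OF this borel_measurable_continuous_onI[OF g]]
  have "(\<lambda>x. g (\<lambda>i. X_proc (t' i) x)) \<in> borel_measurable (X_algebra T)" .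
  also have "(\<lambda>x. g (\<lambda>i. X_proc (t' i) x)) = (\<lambda>x. g (\<lambda>i. X_proc (t i) x))"
    by (intro ext loc) (simp add: t'_def)
  finally show ?thesis .
qed

lemma integrable_snd_power: "integrable Q (\<lambda>x. (1 + snd x) ^ k)"
proof (rule integrableI_nonneg)
  have "integrable N (\<lambda>\<tau>. \<Sum>j\<le>k. real (k choose j) * \<tau> ^ j)"
    by (intro Bochner_Integration.integrable_sum integrable_mult_right integrable_power_time_law[OF M \<beta>])
  also have "(\<lambda>\<tau>. \<Sum>j\<le>k. real (k choose j) * \<tau> ^ j) = (\<lambda>\<tau>. (1 + \<tau>) ^ k)"
    using binomial_ring[of _ "1::real" k] by (auto simp: fun_eq_iff add.commute)
  finally have i: "integrable N (\<lambda>\<tau>. (1 + \<tau>) ^ k)" .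
  have m: "(\<lambda>x. ennreal ((1 + snd x) ^ k)) \<in> borel_measurable Q" by measurable
  have "(\<integral>\<^sup>+ x. ennreal ((1 + snd x) ^ k) \<partial>Q) = (\<integral>\<^sup>+ \<tau>. ennreal ((1 + \<tau>) ^ k) \<partial>N)"
    using nn_integral_snd[OF m] by (simp add: emeasure_P)
  also have "\<dots> = ennreal (\<integral>\<tau>. (1 + \<tau>) ^ k \<partial>N)"
    using i by (intro nn_integral_eq_integral) (auto simp: space_time_law intro!: AE_I2)
  finally show "(\<integral>\<^sup>+ x. ennreal ((1 + snd x) ^ k) \<partial>Q) < \<infinity>" by simp
  show "AE x in Q. 0 \<le> (1 + snd x) ^ k"
    by (rule AE_I2) (auto simp: space_Q)
qed measurable

lemma cylinder_Lp:
  assumes f: "f \<in> Cb_infinity n" and t: "\<And>i. i < n \<Longrightarrow> 0 < t i \<and> t i \<le> T" and q: "1 \<le> q"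
  shows "(\<lambda>(w, \<tau>). f (\<lambda>i. w (t i * \<tau>))) \<in> Lp_fun q Q (X_algebra T)"
proof -
  have eq: "(\<lambda>(w, \<tau>). f (\<lambda>i. w (t i * \<tau>))) = (\<lambda>x. f (\<lambda>i. X_proc (t i) x))"
    by (simp add: X_proc_def case_prod_unfold)
  have m: "(\<lambda>x. f (\<lambda>i. X_proc (t i) x)) \<in> borel_measurable (X_algebra T)"
    by (rule continuous_cylinder_measurable[OF Cb_infinityD(3)[OF f] Cb_infinityD(1)[OF f] t])
  obtain B where B: "\<And>x. \<bar>f x\<bar> \<le> B" using Cb_infinityD(2)[OF f] by (auto simp: bounded_iff)
  have "integrable Q (\<lambda>x. \<bar>f (\<lambda>i. X_proc (t i) x)\<bar> powr q)"
    using B q X_algebra_measurable_Q[OF m]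
    by (intro P.integrable_const_bound[of _ "B powr q"]) (auto intro!: AE_I2 powr_mono2)
  with m show ?thesis unfolding eq Lp_fun_def by simp
qed


text \<open>The derivative contains \<open>h (t i * \<tau>)\<close> and need not be measurable with respect to
  \<open>X_algebra T\<close>; replacing \<open>\<tau>\<close> by \<open>recovered_time\<close> gives a measurable version. It is in \<open>L\<^sup>p\<close> since
  \<open>\<bar>h (t i * \<tau>)\<bar>\<close> is at most a multiple of \<open>1 + \<tau>\<close>, and all moments of \<open>\<tau>\<close> are finite.\<close>

lemma cylinder_derivative_Lp:
  assumes f: "f \<in> Cb_infinity n" and t: "\<And>i. i < n \<Longrightarrow> 0 < t i \<and> t i \<le> T" and p: "1 \<le> p"
    and h: "finite_energy h H K"
  defines "DF \<equiv> \<lambda>x. \<Sum>i<n. h (t i * snd x) * partial_deriv i f (\<lambda>i. X_proc (t i) x)"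
  shows "DF \<in> borel_measurable Q" "\<exists>g\<in>Lp_fun p Q (X_algebra T). AE x in Q. DF x = g x"
proof -
  have hm: "h \<in> borel_measurable borel"
    by (rule borel_measurable_continuous_onI[OF finite_energy_continuous[OF h]])
  have fm: "(\<lambda>x. partial_deriv i f (\<lambda>i. X_proc (t i) x)) \<in> borel_measurable (X_algebra T)" if "i < n" for i
    using Cb_infinity_partial_deriv[OF f that]
    by (intro continuous_cylinder_measurable[OF Cb_infinityD(3) Cb_infinityD(1) t])
  show DFm: "DF \<in> borel_measurable Q"
    unfolding DF_def
    by (intro borel_measurable_sum borel_measurable_times X_algebra_measurable_Q[OF fm] measurable_compose[OF _ hm]) auto
  define g where "g x = (\<Sum>i<n. h (t i * recovered_time x) * partial_deriv i f (\<lambda>i. X_proc (t i) x))" for x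
  have gm: "g \<in> borel_measurable (X_algebra T)"
    unfolding g_def[abs_def] using measurable_recovered_time
    by (intro borel_measurable_sum borel_measurable_times fm measurable_compose[OF _ hm]) auto
  have AE: "AE x in Q. DF x = g x"
    using recovered_time_eq by eventually_elim (simp add: DF_def g_def)
  have "\<exists>B. \<forall>i<n. \<forall>x. \<bar>partial_deriv i f x\<bar> \<le> B i"
  proof -
    have "\<forall>i\<in>{..<n}. \<exists>b. \<forall>x. \<bar>partial_deriv i f x\<bar> \<le> b"
      using Cb_infinity_partial_deriv[OF f, THEN Cb_infinityD(2)] by (auto simp: bounded_iff)
    from bchoice[OF this] show ?thesis by auto
  qed
  then obtain B where B: "\<And>i x. i < n \<Longrightarrow> \<bar>partial_deriv i f x\<bar> \<le> B i" by blast
  define C where "C = (\<Sum>i<n. sqrt K * sqrt T * B i)"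
  have K: "0 \<le> K" by (rule finite_energyD(5)[OF h])
  have B0: "0 \<le> B i" if "i < n" for i using B[OF that, of undefined] by linarith
  have C: "0 \<le> C"
    unfolding C_def using K T B0 by (intro sum_nonneg mult_nonneg_nonneg) auto
  have bound: "\<bar>DF x\<bar> \<le> C * (1 + snd x)" if x: "x \<in> space Q" for x
  proof -
    have \<tau>: "0 \<le> snd x" using x by (auto simp: space_Q)
    have sq: "sqrt (snd x) \<le> 1 + snd x"
      using \<tau> by (intro real_le_lsqrt) (auto simp: power2_eq_square algebra_simps)
    have "\<bar>h (t i * snd x)\<bar> \<le> sqrt K * sqrt T * (1 + snd x)" if "i < n" for i
    proof -
      have "\<bar>h (t i * snd x)\<bar> \<le> sqrt K * sqrt (t i * snd x)"
        using t[OF that] \<tau> by (intro finite_energy_growth[OF h]) simp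
      also have "\<dots> \<le> sqrt K * (sqrt T * (1 + snd x))"
        unfolding real_sqrt_mult using t[OF that] \<tau> K T sq by (intro mult_left_mono mult_mono) auto
      finally show ?thesis by (simp add: mult_ac)
    qed
    then have "\<bar>DF x\<bar> \<le> (\<Sum>i<n. sqrt K * sqrt T * (1 + snd x) * B i)"
      unfolding DF_def using K T \<tau>
      by (intro order_trans[OF sum_abs] sum_mono) (auto simp only: abs_mult lessThan_iff intro!: mult_mono B mult_nonneg_nonneg real_sqrt_ge_zero less_imp_le[OF T])
    also have "\<dots> = C * (1 + snd x)"
      by (simp add: C_def sum_distrib_left sum_distrib_right mult_ac)
    finally show ?thesis .
  qed
  define k where "k = nat \<lceil>p\<rceil>"
  have "integrable Q (\<lambda>x. \<bar>DF x\<bar> powr p)"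
  proof (rule Bochner_Integration.integrable_bound[OF integrable_mult_right[OF integrable_snd_power[of k], of "C powr p"]])
    show "AE x in Q. norm (\<bar>DF x\<bar> powr p) \<le> norm (C powr p * (1 + snd x) ^ k)"
    proof (rule AE_I2)
      fix x assume x: "x \<in> space Q"
      then have \<tau>: "0 \<le> snd x" by (auto simp: space_Q)
      have "\<bar>DF x\<bar> powr p \<le> (C * (1 + snd x)) powr p"
        using bound[OF x] p by (intro powr_mono2) auto
      also have "\<dots> = C powr p * (1 + snd x) powr p"
        using C \<tau> by (simp add: powr_mult)
      also have "\<dots> \<le> C powr p * (1 + snd x) powr real k"
        using \<tau> p by (intro mult_left_mono powr_mono) (auto simp: k_def)
      also have "\<dots> = C powr p * (1 + snd x) ^ k"
        using \<tau> by (simp add: powr_realpow)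
      finally show "norm (\<bar>DF x\<bar> powr p) \<le> norm (C powr p * (1 + snd x) ^ k)" using \<tau> by simp
    qed
  qed (use DFm in measurable)
  also have "?this \<longleftrightarrow> integrable Q (\<lambda>x. \<bar>g x\<bar> powr p)"
    using AE DFm X_algebra_measurable_Q[OF gm] by (intro integrable_cong_AE) auto
  finally show "\<exists>g\<in>Lp_fun p Q (X_algebra T). AE x in Q. DF x = g x"
    using AE gm by (intro bexI[of _ g]) (auto simp: Lp_fun_def)
qed

lemma AE_slice_summable:
  fixes u :: "nat \<Rightarrow> (real \<Rightarrow> real) \<times> real \<Rightarrow> real"
  assumes [measurable]: "\<And>n. u n \<in> borel_measurable Q"
    and fin: "(\<Sum>n. \<integral>\<^sup>+ x. ennreal \<bar>u n x\<bar> \<partial>Q) < \<infinity>"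
  shows "AE \<tau> in N. (\<Sum>n. \<integral>\<^sup>+ w. ennreal \<bar>u n (w, \<tau>)\<bar> \<partial>P) < \<infinity>"
proof -
  have m: "(\<lambda>x. ennreal \<bar>u n x\<bar>) \<in> borel_measurable Q" for n by measurable
  have mi: "(\<lambda>\<tau>. \<integral>\<^sup>+ w. ennreal \<bar>u n (w, \<tau>)\<bar> \<partial>P) \<in> borel_measurable N" for n
    by measurable
  have "(\<integral>\<^sup>+ \<tau>. (\<Sum>n. \<integral>\<^sup>+ w. ennreal \<bar>u n (w, \<tau>)\<bar> \<partial>P) \<partial>N) = (\<Sum>n. \<integral>\<^sup>+ x. ennreal \<bar>u n x\<bar> \<partial>Q)"
    using mi nn_integral_snd[OF m] by (simp add: nn_integral_suminf)
  then have "AE \<tau> in N. (\<Sum>n. \<integral>\<^sup>+ w. ennreal \<bar>u n (w, \<tau>)\<bar> \<partial>P) \<noteq> \<infinity>"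
    using fin mi by (intro nn_integral_PInf_AE) auto
  then show ?thesis by eventually_elim (simp add: less_top)
qed

text \<open>Indices \<open>r k\<close> are chosen such that the \<open>L\<^sup>1\<close> norms of \<open>F (r k)\<close> and \<open>DF (r k) - Z\<close> are below
  \<open>(1 / 2) ^ k\<close>. Almost every \<open>\<tau>\<close>-section of this sequence then has summable norms, and the
  result for fixed time shows that almost every section of \<open>Z\<close> vanishes.\<close>

lemma cylinder_derivative_closable:
  fixes f :: "nat \<Rightarrow> (nat \<Rightarrow> real) \<Rightarrow> real" and n :: "nat \<Rightarrow> nat"
  assumes f: "\<And>k. f k \<in> Cb_infinity (n k)" and t: "\<And>k i. i < n k \<Longrightarrow> 0 < t k i \<and> t k i \<le> T"
    and h: "finite_energy h H K" and p: "1 \<le> p" and q: "1 \<le> q"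
    and Z[measurable]: "Z \<in> borel_measurable Q"
    and F: "\<And>k x. F k x = f k (\<lambda>i. X_proc (t k i) x)"
    and DF: "\<And>k x. DF k x = (\<Sum>i<n k. h (t k i * snd x) * partial_deriv i (f k) (\<lambda>i. X_proc (t k i) x))"
    and limF: "Lp_tendsto q Q F (\<lambda>_. 0)" and limDF: "Lp_tendsto p Q DF Z"
  shows "AE x in Q. Z x = 0"
proof -
  have Fm[measurable]: "F k \<in> borel_measurable Q" for k
    unfolding F[abs_def]
    by (rule X_algebra_measurable_Q[OF continuous_cylinder_measurable[OF Cb_infinityD(3)[OF f] Cb_infinityD(1)[OF f] t]])
  have DFm[measurable]: "DF k \<in> borel_measurable Q" for k
    unfolding DF[abs_def] by (rule cylinder_derivative_Lp(1)[OF f t p h])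
  define a where "a k = (\<integral>\<^sup>+ x. ennreal \<bar>F k x\<bar> \<partial>Q) + (\<integral>\<^sup>+ x. ennreal \<bar>DF k x - Z x\<bar> \<partial>Q)" for k
  have "(\<lambda>k. \<integral>\<^sup>+ x. ennreal \<bar>F k x\<bar> \<partial>Q) \<longlonglongrightarrow> 0"
    using limF q by (intro P.L1_tendsto_if_Lp_tendsto[of _ q]) (auto simp: Lp_tendsto_def)
  moreover have "(\<lambda>k. \<integral>\<^sup>+ x. ennreal \<bar>DF k x - Z x\<bar> \<partial>Q) \<longlonglongrightarrow> 0"
    using limDF p by (intro P.L1_tendsto_if_Lp_tendsto[of _ p]) (auto simp: Lp_tendsto_def)
  ultimately have a: "a \<longlonglongrightarrow> 0"
    unfolding a_def using tendsto_add[of _ 0 sequentially _ 0] by fastforce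
  have "\<exists>r. a r < ennreal ((1 / 2) ^ k)" for k :: nat
  proof -
    have "0 < ennreal ((1 / 2) ^ k)" by simp
    from order_tendstoD(2)[OF a this] show ?thesis by (auto simp: eventually_sequentially)
  qed
  then obtain r where r: "\<And>k. a (r k) < ennreal ((1 / 2) ^ k)" by metis
  have geo: "(\<Sum>k. ennreal ((1 / 2) ^ k)) < \<infinity>"
  proof -
    have "(\<Sum>k. ennreal ((1 / 2) ^ k)) \<noteq> top"
      by (rule ennreal_suminf_neq_top) (auto intro!: summable_geometric)
    then show ?thesis by (simp only: infinity_ennreal_def less_top[symmetric] not_False_eq_True)
  qed
  have sum1: "(\<Sum>k. \<integral>\<^sup>+ x. ennreal \<bar>F (r k) x\<bar> \<partial>Q) < \<infinity>"
  proof (rule le_less_trans[OF suminf_le geo])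
    show "(\<integral>\<^sup>+ x. ennreal \<bar>F (r k) x\<bar> \<partial>Q) \<le> ennreal ((1 / 2) ^ k)" for k
      using r[of k] unfolding a_def by (meson add_increasing2 le_less_trans less_imp_le order_refl zero_le)
  qed auto
  have sum2: "(\<Sum>k. \<integral>\<^sup>+ x. ennreal \<bar>DF (r k) x - Z x\<bar> \<partial>Q) < \<infinity>"
  proof (rule le_less_trans[OF suminf_le geo])
    show "(\<integral>\<^sup>+ x. ennreal \<bar>DF (r k) x - Z x\<bar> \<partial>Q) \<le> ennreal ((1 / 2) ^ k)" for k
      using r[of k] unfolding a_def by (meson add_increasing le_less_trans less_imp_le order_refl zero_le)
  qed auto
  have Mb: "M \<in> borel_measurable borel" using M by (simp add: mittag_leffler_density_def)
  have "AE \<tau> in N. AE w in P. Z (w, \<tau>) = 0"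
    using AE_time_law_pos[OF Mb] AE_slice_summable[OF Fm sum1] AE_slice_summable[OF borel_measurable_diff[OF DFm Z] sum2] AE_space
  proof eventually_elim
    case (elim \<tau>)
    show ?case
    proof (rule closable_along_fast_sequence[OF h, where N = "\<lambda>k. n (r k)" and f = "\<lambda>k. f (r k)"
        and f' = "\<lambda>k i. partial_deriv i (f (r k))" and f'' = "\<lambda>k i j. partial_deriv j (partial_deriv i (f (r k)))"
        and s = "\<lambda>k i. t (r k) i * \<tau>" and F = "\<lambda>k w. F (r k) (w, \<tau>)" and DF = "\<lambda>k w. DF (r k) (w, \<tau>)"])
      show "(\<lambda>w. Z (w, \<tau>)) \<in> borel_measurable P"
        using elim(4) by (intro measurable_compose[OF measurable_Pair2' Z])
      show "C1_bounded (n (r k)) (f (r k)) (\<lambda>i. partial_deriv i (f (r k)))" for k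
        by (rule Cb_infinity_C1_bounded[OF f])
      show "C1_bounded (n (r k)) (partial_deriv i (f (r k))) (\<lambda>j. partial_deriv j (partial_deriv i (f (r k))))"
        if "i < n (r k)" for k i
        by (rule Cb_infinity_C1_bounded[OF Cb_infinity_partial_deriv[OF f that]])
      show "0 \<le> t (r k) i * \<tau>" if "i < n (r k)" for k i
        using t[OF that] elim(1) by simp
    qed (use elim in \<open>simp_all add: F DF X_proc_def\<close>)
  qed
  then show ?thesis
    by (intro AE_Q_swap) auto
qed

end

theorem theorem4p4:
  fixes \<beta> T p q :: real
    and h :: "real \<Rightarrow> real"
    and P :: "(real \<Rightarrow> real) measure"
    and M :: "real \<Rightarrow> real"
  assumes "0 < \<beta>" and "\<beta> < 1" and "0 < T"
    and "wiener_measure P"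
    and "mittag_leffler_density \<beta> M"
    and "1 \<le> p" and "1 \<le> q"
    and "h \<in> cameron_martin"
  shows "Lp_closable (P \<Otimes>\<^sub>M time_law M) (X_algebra T) q p (cylinder_functions T) (dir_deriv h)"
proof -
  interpret time_changed P \<beta> T M
    using assms by unfold_locales auto
  obtain H K where h: "finite_energy h H K"
    using cameron_martin_finite_energy[OF assms(8)] .
  have DF: "dir_deriv h (\<lambda>(w, \<tau>). f (\<lambda>i. w (t i * \<tau>)))
      = (\<lambda>x. \<Sum>i<n. h (t i * snd x) * partial_deriv i f (\<lambda>i. X_proc (t i) x))"
    if "f \<in> Cb_infinity n" for f n t
    using dir_deriv_cylinder[OF that, of h t] by (auto simp: fun_eq_iff X_proc_def)
  show ?thesis
    unfolding Lp_closable_def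
  proof (intro conjI ballI allI impI)
    show "cylinder_functions T \<subseteq> Lp_fun q Q (X_algebra T)"
      using cylinder_Lp[OF _ _ assms(7)] by (auto simp: cylinder_functions_def)
  next
    fix F assume "F \<in> cylinder_functions T"
    then obtain n t f where F: "\<And>i. i < n \<Longrightarrow> 0 < t i \<and> t i \<le> T" "f \<in> Cb_infinity n"
      "F = (\<lambda>(w, \<tau>). f (\<lambda>i. w (t i * \<tau>)))"
      unfolding cylinder_functions_def by blast
    show "\<exists>g\<in>Lp_fun p Q (X_algebra T). AE x in Q. dir_deriv h F x = g x"
      unfolding F(3) DF[OF F(2)] by (rule cylinder_derivative_Lp(2)[OF F(2,1) assms(6) h])
  next
    fix F Z
    assume *: "(\<forall>k. F k \<in> cylinder_functions T) \<and> Z \<in> Lp_fun p Q (X_algebra T) \<and>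
        Lp_tendsto q Q F (\<lambda>_. 0) \<and> Lp_tendsto p Q (\<lambda>k. dir_deriv h (F k)) Z"
    then have "\<forall>k. \<exists>n t f. (\<forall>i<n. 0 < t i \<and> t i \<le> T) \<and> f \<in> Cb_infinity n \<and>
        F k = (\<lambda>(w, \<tau>). f (\<lambda>i. w (t i * \<tau>)))"
      unfolding cylinder_functions_def by blast
    then obtain n t f where F: "\<And>k i. i < n k \<Longrightarrow> 0 < t k i \<and> t k i \<le> T" "\<And>k. f k \<in> Cb_infinity (n k)"
      "\<And>k. F k = (\<lambda>(w, \<tau>). f k (\<lambda>i. w (t k i * \<tau>)))"
      by metis
    show "AE x in Q. Z x = 0"
    proof (rule cylinder_derivative_closable[OF F(2,1) h assms(6,7)])
      show "Z \<in> borel_measurable Q"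
        using * by (intro X_algebra_measurable_Q) (simp add: Lp_fun_def)
      show "Lp_tendsto q Q F (\<lambda>_. 0)" "Lp_tendsto p Q (\<lambda>k. dir_deriv h (F k)) Z" using * by auto
      show "F k x = f k (\<lambda>i. X_proc (t k i) x)" for k x
        by (simp add: F(3) X_proc_def case_prod_unfold)
      show "dir_deriv h (F k) x = (\<Sum>i<n k. h (t k i * snd x) * partial_deriv i (f k) (\<lambda>i. X_proc (t k i) x))" for k x
        unfolding F(3) DF[OF F(2)] ..
    qed
  qed
qed

end
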